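(* Let $\hat V$ be an $\omega$-nonstandard model of $ZFC^-$, and let $\kappa$ be an infinite regular cardinal with $\kappa<\min(\mathfrak{p}_{\hat V}^+,\mathfrak{t}_{\hat V})$. Then there is a unique regular cardinal $\lambda$ with $(\kappa,\lambda)\in\mathcal{C}_{\hat V}$; moreover this same $\lambda$ is the unique regular cardinal with $(\lambda,\kappa)\in\mathcal{C}_{\hat V}$.
   Context: $ZFC^-$ denotes $ZFC$ without the powerset axiom, with replacement strengthened to collection and choice strengthened to the well-ordering principle. For a model $\hat V \models ZFC^-$, write $\hat\omega$ for $\omega^{\hat V}$ and $\hat<$ for its order. $\hat V$ is $\omega$-nonstandard if $\hat\omega \neq \omega$. For infinite regular cardinals $\kappa,\theta$, a $(\kappa,\theta)$-cut in a linear order $(L,<)$ is a pair of sequences $(a_\alpha:\alpha<\kappa)$ strictly increasing and $(b_\beta:\beta<\theta)$ strictly decreasing with $a_\alpha<b_\beta$ for all $\alpha,\beta$, such that no $c\in L$ satisfies $a_\alpha<c<b_\beta$ for all $\alpha,\beta$. $\mathcal{C}_{\hat V}$ is the set of pairs $(\kappa,\theta)$ of infinite regular cardinals such that $(\hat\omega,\hat<)$ admits a $(\kappa,\theta)$-cut, and $\mathfrak{p}_{\hat V}=\min\{\kappa+\theta:(\kappa,\theta)\in\mathcal{C}_{\hat V}\}$. A tree is a partial order with meets and a minimum element in which the predecessors of each element are linearly ordered; $\mathrm{tree\text{-}tops}(T)$ is the least cardinal $\kappa$ such that there is a strictly increasing sequence $(s_\alpha:\alpha<\kappa)$ in $T$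 with no upper bound in $T$. $\mathfrak{t}_{\hat V}$ is the minimum over all $\hat n\in\hat\omega$ of $\mathrm{tree\text{-}tops}$ of the (external) tree $(\hat n^{<\hat n},\subsetneq)$ of sequences (in $\hat V$) from $\hat n$ of $\hat V$-length less than $\hat n$, ordered by proper initial segment. *)

theory Defs
  imports Main
begin

datatype fm =
    FMem nat nat
  | FEq nat nat
  | FNeg fm
  | FConj fm fm
  | FEx nat fm

fun sat :: "('m \<Rightarrow> 'm \<Rightarrow> bool) \<Rightarrow> (nat \<Rightarrow> 'm) \<Rightarrow> fm \<Rightarrow> bool" where
  "sat E env (FMem i j) = E (env i) (env j)"
| "sat E env (FEq i j) = (env i = env j)"
| "sat E env (FNeg p) = (\<not> sat E env p)"
| "sat E env (FConj p q) = (sat E env p \<and> sat E env q)"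
| "sat E env (FEx i p) = (\<exists>x. sat E (env(i := x)) p)"

definition is_empty :: "('m \<Rightarrow> 'm \<Rightarrow> bool) \<Rightarrow> 'm \<Rightarrow> bool" where
  "is_empty E e \<longleftrightarrow> (\<forall>z. \<not> E z e)"

definition is_succ :: "('m \<Rightarrow> 'm \<Rightarrow> bool) \<Rightarrow> 'm \<Rightarrow> 'm \<Rightarrow> bool" where
  "is_succ E s x \<longleftrightarrow> (\<forall>z. E z s \<longleftrightarrow> E z x \<or> z = x)"

definition is_upair :: "('m \<Rightarrow> 'm \<Rightarrow> bool) \<Rightarrow> 'm \<Rightarrow> 'm \<Rightarrow> 'm \<Rightarrow> bool" where
  "is_upair E z x y \<longleftrightarrow> (\<forall>w. E w z \<longleftrightarrow> w = x \<or> w = y)"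

definition is_opair :: "('m \<Rightarrow> 'm \<Rightarrow> bool) \<Rightarrow> 'm \<Rightarrow> 'm \<Rightarrow> 'm \<Rightarrow> bool" where
  "is_opair E p x y \<longleftrightarrow> (\<forall>z. E z p \<longleftrightarrow> is_upair E z x x \<or> is_upair E z x y)"

definition internal_wellorders :: "('m \<Rightarrow> 'm \<Rightarrow> bool) \<Rightarrow> 'm \<Rightarrow> 'm \<Rightarrow> bool" where
  "internal_wellorders E r a \<longleftrightarrow>
     (let R = (\<lambda>x y. \<exists>p. E p r \<and> is_opair E p x y) in
       (\<forall>x. E x a \<longrightarrow> \<not> R x x) \<and>
       (\<forall>x y z. E x a \<longrightarrow> E y a \<longrightarrow> E z a \<longrightarrow> R x y \<longrightarrow> R y z \<longrightarrow> R x z) \<and>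
       (\<forall>x y. E x a \<longrightarrow> E y a \<longrightarrow> R x y \<or> x = y \<or> R y x) \<and>
       (\<forall>s. (\<forall>x. E x s \<longrightarrow> E x a) \<longrightarrow> (\<exists>x. E x s) \<longrightarrow>
            (\<exists>x. E x s \<and> (\<forall>y. E y s \<longrightarrow> y \<noteq> x \<longrightarrow> R x y))))"

text \<open>The axioms of ZFC without powerset, with collection instead of replacement
  and the well-ordering principle instead of choice.  Schemas are taken with
  arbitrary parameters (the assignment env).\<close>

definition zfc_minus :: "('m \<Rightarrow> 'm \<Rightarrow> bool) \<Rightarrow> bool" where
  "zfc_minus E \<longleftrightarrow>
     \<comment> \<open>extensionality\<close>
     (\<forall>x y. (\<forall>z. E z x \<longleftrightarrow> E z y) \<longrightarrow> x = y) \<and>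
     \<comment> \<open>foundation\<close>
     (\<forall>x. (\<exists>y. E y x) \<longrightarrow> (\<exists>y. E y x \<and> \<not> (\<exists>z. E z y \<and> E z x))) \<and>
     \<comment> \<open>pairing\<close>
     (\<forall>x y. \<exists>z. E x z \<and> E y z) \<and>
     \<comment> \<open>union\<close>
     (\<forall>x. \<exists>u. \<forall>y z. E z y \<longrightarrow> E y x \<longrightarrow> E z u) \<and>
     \<comment> \<open>infinity\<close>
     (\<exists>w. (\<exists>e. E e w \<and> is_empty E e) \<and> (\<forall>x. E x w \<longrightarrow> (\<exists>s. E s w \<and> is_succ E s x))) \<and>
     \<comment> \<open>separation schema\<close>
     (\<forall>\<phi> env v a. \<exists>b. \<forall>x. E x b \<longleftrightarrow> E x a \<and> sat E (env(v := x)) \<phi>) \<and>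
     \<comment> \<open>collection schema\<close>
     (\<forall>\<phi> env v u a. v \<noteq> u \<longrightarrow>
        (\<forall>x. E x a \<longrightarrow> (\<exists>y. sat E (env(v := x, u := y)) \<phi>)) \<longrightarrow>
        (\<exists>b. \<forall>x. E x a \<longrightarrow> (\<exists>y. E y b \<and> sat E (env(v := x, u := y)) \<phi>))) \<and>
     \<comment> \<open>well-ordering principle\<close>
     (\<forall>a. \<exists>r. internal_wellorders E r a)"

definition inductive_set_in :: "('m \<Rightarrow> 'm \<Rightarrow> bool) \<Rightarrow> 'm \<Rightarrow> bool" where
  "inductive_set_in E w \<longleftrightarrow>
     (\<exists>e. E e w \<and> is_empty E e) \<and> (\<forall>x. E x w \<longrightarrow> (\<exists>s. E s w \<and> is_succ E s x))"

definition is_omega :: "('m \<Rightarrow> 'm \<Rightarrow> bool) \<Rightarrow> 'm \<Rightarrow> bool" where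
  "is_omega E w \<longleftrightarrow> inductive_set_in E w \<and>
     (\<forall>v. inductive_set_in E v \<longrightarrow> (\<forall>x. E x w \<longrightarrow> E x v))"

definition omega_hat :: "('m \<Rightarrow> 'm \<Rightarrow> bool) \<Rightarrow> 'm set" where
  "omega_hat E = {x. \<exists>w. is_omega E w \<and> E x w}"

definition omega_nonstandard :: "('m \<Rightarrow> 'm \<Rightarrow> bool) \<Rightarrow> bool" where
  "omega_nonstandard E \<longleftrightarrow>
     \<not> (\<exists>f :: nat \<Rightarrow> 'm. bij_betw f UNIV (omega_hat E) \<and> (\<forall>m n. m < n \<longleftrightarrow> E (f m) (f n)))"

definition inf_regular :: "'a rel \<Rightarrow> bool" where
  "inf_regular r \<longleftrightarrow> Card_order r \<and> infinite (Field r) \<and> regularCard r"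

definition has_cut :: "('m \<Rightarrow> 'm \<Rightarrow> bool) \<Rightarrow> 'a rel \<Rightarrow> 'b rel \<Rightarrow> bool" where
  "has_cut E \<kappa> \<theta> \<longleftrightarrow>
     (\<exists>(a :: 'a \<Rightarrow> 'm) (b :: 'b \<Rightarrow> 'm).
        (\<forall>\<alpha>\<in>Field \<kappa>. a \<alpha> \<in> omega_hat E) \<and> (\<forall>\<beta>\<in>Field \<theta>. b \<beta> \<in> omega_hat E) \<and>
        (\<forall>\<alpha> \<alpha>'. (\<alpha>, \<alpha>') \<in> \<kappa> \<longrightarrow> \<alpha> \<noteq> \<alpha>' \<longrightarrow> E (a \<alpha>) (a \<alpha>')) \<and>
        (\<forall>\<beta> \<beta>'. (\<beta>, \<beta>') \<in> \<theta> \<longrightarrow> \<beta> \<noteq> \<beta>' \<longrightarrow> E (b \<beta>') (b \<beta>)) \<and>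
        (\<forall>\<alpha>\<in>Field \<kappa>. \<forall>\<beta>\<in>Field \<theta>. E (a \<alpha>) (b \<beta>)) \<and>
        \<not> (\<exists>c\<in>omega_hat E. (\<forall>\<alpha>\<in>Field \<kappa>. E (a \<alpha>) c) \<and> (\<forall>\<beta>\<in>Field \<theta>. E c (b \<beta>))))"

definition in_C :: "('m \<Rightarrow> 'm \<Rightarrow> bool) \<Rightarrow> 'a rel \<Rightarrow> 'b rel \<Rightarrow> bool" where
  "in_C E \<kappa> \<theta> \<longleftrightarrow> inf_regular \<kappa> \<and> inf_regular \<theta> \<and> has_cut E \<kappa> \<theta>"

text \<open>kappa < p^+ , i.e. kappa \<le> p = min{mu + nu : (mu,nu) in C}; for infinite cardinals
  mu + nu = max(mu,nu).  Cardinals mu, nu in C are represented on subsets of 'm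
  (every cut has both sides of size at most |omega-hat|).\<close>
definition below_p_plus :: "('m \<Rightarrow> 'm \<Rightarrow> bool) \<Rightarrow> 'a rel \<Rightarrow> bool" where
  "below_p_plus E \<kappa> \<longleftrightarrow>
     (\<forall>(\<mu> :: 'm rel) (\<nu> :: 'm rel). in_C E \<mu> \<nu> \<longrightarrow> (\<kappa>, \<mu>) \<in> ordLeq \<or> (\<kappa>, \<nu>) \<in> ordLeq)"

definition is_seq :: "('m \<Rightarrow> 'm \<Rightarrow> bool) \<Rightarrow> 'm \<Rightarrow> 'm \<Rightarrow> bool" where
  "is_seq E n s \<longleftrightarrow> (\<exists>m. E m n \<and>
      (\<forall>p. E p s \<longrightarrow> (\<exists>x y. is_opair E p x y \<and> E x m \<and> E y n)) \<and>
      (\<forall>x. E x m \<longrightarrow> (\<exists>p y. E p s \<and> is_opair E p x y)) \<and>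
      (\<forall>x y y' p p'. E p s \<longrightarrow> E p' s \<longrightarrow> is_opair E p x y \<longrightarrow> is_opair E p' x y' \<longrightarrow> y = y'))"

definition seq_tree :: "('m \<Rightarrow> 'm \<Rightarrow> bool) \<Rightarrow> 'm \<Rightarrow> 'm set" where
  "seq_tree E n = {s. is_seq E n s}"

text \<open>Proper initial segment of sequences (as sets of pairs): proper inclusion.\<close>
definition seq_less :: "('m \<Rightarrow> 'm \<Rightarrow> bool) \<Rightarrow> 'm \<Rightarrow> 'm \<Rightarrow> bool" where
  "seq_less E s t \<longleftrightarrow> (\<forall>z. E z s \<longrightarrow> E z t) \<and> s \<noteq> t"

definition unbounded_seq :: "'m set \<Rightarrow> ('m \<Rightarrow> 'm \<Rightarrow> bool) \<Rightarrow> 'u rel \<Rightarrow> bool" where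
  "unbounded_seq T lt \<mu> \<longleftrightarrow>
     (\<exists>s :: 'u \<Rightarrow> 'm. (\<forall>\<alpha>\<in>Field \<mu>. s \<alpha> \<in> T) \<and>
        (\<forall>\<alpha> \<beta>. (\<alpha>, \<beta>) \<in> \<mu> \<longrightarrow> \<alpha> \<noteq> \<beta> \<longrightarrow> lt (s \<alpha>) (s \<beta>)) \<and>
        \<not> (\<exists>u\<in>T. \<forall>\<alpha>\<in>Field \<mu>. lt (s \<alpha>) u))"

text \<open>kappa < t: for every n in omega-hat, tree-tops of n^{<n} exceeds kappa, i.e. no
  infinite cardinal mu \<le> kappa carries a strictly increasing unbounded sequence.\<close>
definition below_t :: "('m \<Rightarrow> 'm \<Rightarrow> bool) \<Rightarrow> 'a rel \<Rightarrow> bool" where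
  "below_t E \<kappa> \<longleftrightarrow>
     (\<forall>n\<in>omega_hat E. \<forall>\<mu> :: 'a rel. Card_order \<mu> \<and> infinite (Field \<mu>) \<and> (\<mu>, \<kappa>) \<in> ordLeq
        \<longrightarrow> \<not> unbounded_seq (seq_tree E n) (seq_less E) \<mu>)"

end

theory Submission
  imports Defs
begin

text \<open>
  An order-reversing internal function on a large \<open>n\<close> turns a \<open>(\<kappa>,\<lambda>)\<close>-cut into a
  \<open>(\<lambda>,\<kappa>)\<close>-cut, so it suffices to treat cuts with lower cofinality \<open>\<kappa>\<close>.

  Existence: the standard cut is an \<open>(\<omega>,\<nu>)\<close>-cut with \<open>\<nu> \<ge> p \<ge> \<kappa>\<close>; reflecting a decreasing sequence
  of length \<open>\<kappa>\<close> gives a bounded increasing one, and \<open>\<lambda>\<close> is the coinitiality of its set of upper bounds.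

  Uniqueness: given two increasing sequences \<open>a0\<close> and \<open>a1\<close> of length \<open>\<kappa>\<close>, build along \<open>\<kappa>\<close> a path of
  internal functions in \<open>n\<^sup><\<^sup>n\<close>, the \<open>i\<close>-th one mapping \<open>[0, a0 i]\<close> into \<open>[0, a1 i]\<close> and
  \<open>a0 i\<close> to \<open>a1 i\<close>.  Since \<open>\<kappa> < t\<close>, limit stages and the whole path have upper bounds.  An upper
  bound \<open>u\<close> of the whole path transports the upper half of the first cut onto that of the second
  up to coinitiality.
\<close>

unbundle cardinal_syntax

section \<open>Cofinalities of linear orders\<close>

lemma wf_strict_Card_order:
  assumes "Card_order r" shows "wf (r - Id)"
  using assms unfolding card_order_on_def well_order_on_def by blast

lemma card_order_cases:
  assumes "Card_order r" "i \<in> Field r" "j \<in> Field r"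
  shows "(i, j) \<in> r \<or> (j, i) \<in> r"
  using assms unfolding card_order_on_def well_order_on_def linear_order_on_def
    partial_order_on_def preorder_on_def refl_on_def total_on_def by metis

text \<open>Regularity says that an index set smaller than \<open>r\<close> has no cofinal image;
  totality of \<open>r\<close> turns an index that no image point passes into an upper
  bound.\<close>

lemma regular_bounded:
  assumes r: "Card_order r" "regularCard r" and "f ` A \<subseteq> Field r" "|A| <o r"
  shows "\<exists>a\<in>Field r. \<forall>x\<in>A. (f x, a) \<in> r"
proof -
  have "\<not> |f ` A| =o r"
    using card_of_image[of f A] assms(4) ordLeq_ordLess_trans not_ordLess_ordIso by blast
  then have "\<not> cofinal (f ` A) r" using assms(2,3) unfolding regularCard_def by blast
  then obtain a where "a \<in> Field r" "\<forall>b\<in>f ` A. \<not> (a \<noteq> b \<and> (a, b) \<in> r)"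
    unfolding cofinal_def by blast
  then show ?thesis using card_order_cases[OF r(1)] assms(3)
    by (metis image_eqI subsetD)
qed

text \<open>This isolates the way two coinitialities are compared. If \<open>s\<close> were shorter
  than \<open>r\<close>, the witnesses from \<open>ex\<close> would be bounded by one
  \<open>a\<close>, and by \<open>up\<close> this \<open>a\<close> would be related to every
  \<open>j\<close>, against \<open>nex\<close>. If \<open>r\<close> were shorter, a bound for the
  witnesses from \<open>nex\<close> would contradict \<open>ex\<close> through \<open>down\<close>.
  The two orders may live on different types.\<close>

lemma regular_ordIsoI:
  assumes r: "Card_order r" "regularCard r" and s: "Card_order s" "regularCard s"
    and up: "\<And>i i' j. (i, i') \<in> r \<Longrightarrow> j \<in> Field s \<Longrightarrow> R i j \<Longrightarrow> R i' j"
    and down: "\<And>i j j'. i \<in> Field r \<Longrightarrow> (j, j') \<in> s \<Longrightarrow> R i j' \<Longrightarrow> R i j"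
    and ex: "\<And>j. j \<in> Field s \<Longrightarrow> \<exists>i\<in>Field r. R i j"
    and nex: "\<And>i. i \<in> Field r \<Longrightarrow> \<exists>j\<in>Field s. \<not> R i j"
  shows "r =o s"
proof -
  have wo: "Well_order r" "Well_order s" using r s by (auto simp: card_order_on_def)
  have "\<not> s <o r"
  proof
    assume "s <o r"
    then have lt: "|Field s| <o r"
      using card_of_Field_ordIso[OF s(1)] ordIso_ordLess_trans by blast
    obtain f where f: "\<And>j. j \<in> Field s \<Longrightarrow> f j \<in> Field r \<and> R (f j) j" using ex by metis
    then obtain a where "a \<in> Field r" "\<forall>j\<in>Field s. (f j, a) \<in> r"
      using regular_bounded[OF r _ lt, of f] by blast
    then show False using nex[of a] f up by blast
  qed
  moreover have "\<not> r <o s"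
  proof
    assume "r <o s"
    then have lt: "|Field r| <o s"
      using card_of_Field_ordIso[OF r(1)] ordIso_ordLess_trans by blast
    obtain f where f: "\<And>i. i \<in> Field r \<Longrightarrow> f i \<in> Field s \<and> \<not> R i (f i)" using nex by metis
    then obtain a where "a \<in> Field s" "\<forall>i\<in>Field r. (f i, a) \<in> s"
      using regular_bounded[OF s _ lt, of f] by blast
    then show False using ex[of a] f down by blast
  qed
  ultimately show ?thesis
    using ordLess_or_ordLeq[OF wo] ordLess_or_ordLeq[OF wo(2,1)] by (simp add: ordIso_iff_ordLeq)
qed

text \<open>The index order is the cardinality of a coinitial set \<open>X\<close> of least size, so
  it lives on \<open>U\<close> itself. Recursion along it never stops early, because fewer than
  \<open>|X|\<close> values cannot be coinitial. That \<open>Field r\<close> lies in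
  \<open>U\<close> later bounds the size of \<open>r\<close>.\<close>

lemma coinitial_sequence:
  fixes lt :: "'x \<Rightarrow> 'x \<Rightarrow> bool"
  assumes trans: "\<And>x y z. x \<in> U \<Longrightarrow> y \<in> U \<Longrightarrow> z \<in> U \<Longrightarrow> lt x y \<Longrightarrow> lt y z \<Longrightarrow> lt x z"
    and linear: "\<And>x y. x \<in> U \<Longrightarrow> y \<in> U \<Longrightarrow> lt x y \<or> x = y \<or> lt y x"
    and irrefl: "\<And>x. x \<in> U \<Longrightarrow> \<not> lt x x"
    and nonempty: "U \<noteq> {}"
    and no_least: "\<And>x. x \<in> U \<Longrightarrow> \<exists>y\<in>U. lt y x"
  obtains r :: "'x rel" and b :: "'x \<Rightarrow> 'x" where
    "Card_order r" "infinite (Field r)" "regularCard r" "Field r \<subseteq> U"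
    "\<And>i. i \<in> Field r \<Longrightarrow> b i \<in> U"
    "\<And>i j. (i, j) \<in> r \<Longrightarrow> i \<noteq> j \<Longrightarrow> lt (b j) (b i)"
    "\<And>x. x \<in> U \<Longrightarrow> \<exists>i\<in>Field r. lt (b i) x"
proof -
  define coinitial where "coinitial X \<longleftrightarrow> (\<forall>x\<in>U. \<exists>y\<in>X. y = x \<or> lt y x)" for X
  have "coinitial U" unfolding coinitial_def by blast
  then have "card_of ` {X. X \<subseteq> U \<and> coinitial X} \<noteq> {}" by blast
  moreover have "\<forall>r\<in>card_of ` {X. X \<subseteq> U \<and> coinitial X}. Card_order r" using card_of_Card_order by blast
  ultimately have "\<exists>r\<in>card_of ` {X. X \<subseteq> U \<and> coinitial X}.
      \<forall>r'\<in>card_of ` {X. X \<subseteq> U \<and> coinitial X}. r \<le>o r'"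
    by (rule exists_minim_Card_order)
  then obtain r0 where "r0 \<in> card_of ` {X. X \<subseteq> U \<and> coinitial X}"
    and r0: "\<forall>r'\<in>card_of ` {X. X \<subseteq> U \<and> coinitial X}. r0 \<le>o r'" ..
  then obtain X where X: "X \<subseteq> U" "coinitial X" and "r0 = |X|" by blast
  then have minimal: "|X| \<le>o |Y|" if "Y \<subseteq> U" "coinitial Y" for Y using r0 that by blast
  define r where "r = |X|"
  have card: "Card_order r" and field: "Field r = X" unfolding r_def by (rule card_of_Card_order, rule Field_card_of)
  \<comment> \<open>Recursion condition: the indices are the elements of \<open>X\<close>
    themselves. A value at or below its own index makes the sequence coinitial, and one below all
    earlier values makes it decreasing.\<close>
  define P where "P f x y \<longleftrightarrow> (x \<in> X \<longrightarrow> y \<in> U \<and> (y = x \<or> lt y x) \<and> (\<forall>z. (z, x) \<in> r - Id \<longrightarrow> lt y (f z)))"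
    for f x y
  have "\<exists>b. \<forall>x. P b x (b x)"
  proof (rule dependent_wf_choice)
    show "wf (r - Id)" using card by (rule wf_strict_Card_order)
  next
    show "P f x y = P g x y" if "\<And>z. (z, x) \<in> r - Id \<Longrightarrow> f z = g z" for f g x y
      using that unfolding P_def by auto
  next
    fix x f assume prev: "\<And>z. (z, x) \<in> r - Id \<Longrightarrow> P f z (f z)"
    show "\<exists>y. P f x y"
    proof (cases "x \<in> X")
      case True
      let ?Y = "f ` underS r x"
      have mem: "z \<in> X" if "(z, x) \<in> r" for z using that field by (auto simp: Field_def)
      have sub: "?Y \<subseteq> U" using prev mem unfolding P_def underS_def by blast
      have "|?Y| <o |X|"
        using card_of_underS[OF card, of x] card_of_image[of f "underS r x"] True field
          ordLeq_ordLess_trans unfolding r_def by blast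
      then have "\<not> coinitial ?Y" using minimal[OF sub] not_ordLess_ordLeq by blast
      \<comment> \<open>No earlier value is at or below \<open>w\<close>, so by linearity
        \<open>w\<close> is strictly below all of them. The smaller of \<open>w\<close> and
        \<open>x\<close> then serves as the value at \<open>x\<close>.\<close>
      then obtain w where w: "w \<in> U" "\<And>y. y \<in> ?Y \<Longrightarrow> y \<noteq> w \<and> \<not> lt y w"
        unfolding coinitial_def by blast
      have wlt: "lt w (f z)" if "(z, x) \<in> r - Id" for z
      proof -
        have "f z \<in> ?Y" using that unfolding underS_def by auto
        then show ?thesis using w linear[of "f z" w] sub by blast
      qed
      have xU: "x \<in> U" using True X by blast
      show ?thesis
      proof (cases "lt x w")
        case True
        have "lt x (f z)" if "(z, x) \<in> r - Id" for z
        proof (rule trans[OF xU w(1) _ True wlt[OF that]])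
          show "f z \<in> U" using that prev[OF that] mem unfolding P_def by blast
        qed
        then show ?thesis unfolding P_def using xU by blast
      next
        case False
        then have "w = x \<or> lt w x" using linear xU w(1) by blast
        then show ?thesis unfolding P_def using w(1) wlt by blast
      qed
    qed (simp add: P_def)
  qed
  then obtain b where b: "\<And>x. P b x (b x)" by blast
  have bU: "b i \<in> U" and ble: "b i = i \<or> lt (b i) i" if "i \<in> X" for i
    using b[of i] that unfolding P_def by auto
  have dec: "lt (b j) (b i)" if "(i, j) \<in> r" "i \<noteq> j" for i j
    using b[of j] that field unfolding P_def by (auto simp: Field_def)
  have coin: "\<exists>i\<in>X. lt (b i) x" if x: "x \<in> U" for x
  proof -
    obtain y where y: "y \<in> U" "lt y x" using no_least x by blast
    then obtain i where i: "i \<in> X" "i = y \<or> lt i y" using X(2) unfolding coinitial_def by blast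
    then show ?thesis using ble[of i] bU[of i] y x trans X(1) by (metis subsetD)
  qed
  have inf: "infinite X"
  proof
    assume fin: "finite X"
    have "X \<noteq> {}" using nonempty coin by blast
    with fin have "\<exists>x\<in>X. \<forall>y\<in>X. \<not> lt y x" using X(1)
    proof (induction rule: finite_ne_induct)
      case (singleton x)
      then show ?case using irrefl by blast
    next
      case (insert z F)
      then obtain x where x: "x \<in> F" "\<forall>y\<in>F. \<not> lt y x" by blast
      show ?case
      proof (cases "lt z x")
        case True
        have "\<not> lt y z" if "y \<in> F" for y
          using that x True trans[of y z x] insert.prems by blast
        then show ?thesis using irrefl[of z] insert.prems by blast
      qed (use x in blast)
    qed
    then obtain x where x: "x \<in> X" "\<forall>y\<in>X. \<not> lt y x" by blast
    then obtain i where "i \<in> U" "lt i x" using no_least X(1) by blast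
    then obtain j where "j \<in> X" "j = i \<or> lt j i" using X(2) unfolding coinitial_def by blast
    then show False using x trans[of j i x] \<open>lt i x\<close> \<open>i \<in> U\<close> X(1) by blast
  qed
  \<comment> \<open>Restricting \<open>b\<close> to a cofinal \<open>K\<close> still gives a
    coinitial set, so the minimality of \<open>|X|\<close> forces \<open>K\<close> to have full
    size.\<close>
  have "regularCard r" unfolding regularCard_def
  proof (intro allI impI, elim conjE)
    fix K assume K: "K \<subseteq> Field r" "cofinal K r"
    have "coinitial (b ` K)" unfolding coinitial_def
    proof
      fix x assume x: "x \<in> U"
      then obtain i where i: "i \<in> X" "lt (b i) x" using coin by blast
      then obtain k where k: "k \<in> K" "i \<noteq> k" "(i, k) \<in> r" using K(2) field unfolding cofinal_def by blast
      then have "lt (b k) x" using dec[OF k(3,2)] i x bU K(1) field trans[of "b k" "b i" x] by blast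
      then show "\<exists>y\<in>b ` K. y = x \<or> lt y x" using k by blast
    qed
    moreover have "b ` K \<subseteq> U" using K(1) field bU by blast
    ultimately have "|X| \<le>o |b ` K|" using minimal by blast
    then have "r \<le>o |K|" using card_of_image ordLeq_transitive unfolding r_def by blast
    moreover have "|K| \<le>o r" using K(1) field unfolding r_def by (simp add: card_of_mono1)
    ultimately show "|K| =o r" using ordIso_iff_ordLeq by blast
  qed
  with card inf field X(1) bU dec coin show thesis by (intro that[of r b]) auto
qed

section \<open>Arithmetic of the internal natural numbers\<close>

definition FOr where "FOr p q = FNeg (FConj (FNeg p) (FNeg q))"
definition FImp where "FImp p q = FNeg (FConj p (FNeg q))"
definition FIff where "FIff p q = FConj (FImp p q) (FImp q p)"
definition FAll where "FAll i p = FNeg (FEx i (FNeg p))"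

text \<open>Variables 100 and 101 are reserved as bound variables.\<close>

definition FOpair :: "nat \<Rightarrow> nat \<Rightarrow> nat \<Rightarrow> fm" where
  "FOpair p x y = FAll 100 (FIff (FMem 100 p)
     (FOr (FAll 101 (FIff (FMem 101 100) (FEq 101 x)))
          (FAll 101 (FIff (FMem 101 100) (FOr (FEq 101 x) (FEq 101 y))))))"

lemma sat_derived [simp]:
  "sat E e (FOr p q) \<longleftrightarrow> sat E e p \<or> sat E e q"
  "sat E e (FImp p q) \<longleftrightarrow> (sat E e p \<longrightarrow> sat E e q)"
  "sat E e (FIff p q) \<longleftrightarrow> (sat E e p \<longleftrightarrow> sat E e q)"
  "sat E e (FAll i p) \<longleftrightarrow> (\<forall>x. sat E (e(i := x)) p)"
  by (auto simp: FOr_def FImp_def FIff_def FAll_def)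

lemma sat_FOpair [simp]:
  assumes "p < 100" "x < 100" "y < 100"
  shows "sat E e (FOpair p x y) \<longleftrightarrow> is_opair E (e p) (e x) (e y)"
  using assms by (simp add: FOpair_def is_opair_def is_upair_def)

section \<open>Pairs, products and successors inside the model\<close>

locale zfc_minus_model =
  fixes E :: "'m \<Rightarrow> 'm \<Rightarrow> bool"
  assumes zfc: "zfc_minus E"
begin

lemmas axioms = zfc[unfolded zfc_minus_def]

lemma ext: "(\<And>z. E z x \<longleftrightarrow> E z y) \<Longrightarrow> x = y"
  using axioms[THEN conjunct1] by blast

lemma foundation:
  assumes "E y x"
  obtains y' where "E y' x" "\<And>z. E z y' \<Longrightarrow> \<not> E z x"
  using axioms[THEN conjunct2, THEN conjunct1] assms by blast

lemma pairing: "\<exists>z. E x z \<and> E y z"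
  using axioms[THEN conjunct2, THEN conjunct2, THEN conjunct1] by blast

lemma union: "\<exists>u. \<forall>y z. E z y \<longrightarrow> E y x \<longrightarrow> E z u"
  using axioms[THEN conjunct2, THEN conjunct2, THEN conjunct2, THEN conjunct1] by blast

lemma infinity: "\<exists>w. inductive_set_in E w"
  using axioms[THEN conjunct2, THEN conjunct2, THEN conjunct2, THEN conjunct2, THEN conjunct1]
  unfolding inductive_set_in_def .

lemma separation: "\<exists>b. \<forall>x. E x b \<longleftrightarrow> E x a \<and> sat E (env(v := x)) \<phi>"
  using axioms[THEN conjunct2, THEN conjunct2, THEN conjunct2, THEN conjunct2, THEN conjunct2,
      THEN conjunct1] by (elim allE)

lemma collection:
  assumes "v \<noteq> u" "\<And>x. E x a \<Longrightarrow> \<exists>y. sat E (env(v := x, u := y)) \<phi>"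
  shows "\<exists>b. \<forall>x. E x a \<longrightarrow> (\<exists>y. E y b \<and> sat E (env(v := x, u := y)) \<phi>)"
  using axioms[THEN conjunct2, THEN conjunct2, THEN conjunct2, THEN conjunct2, THEN conjunct2,
      THEN conjunct2, THEN conjunct1, rule_format, of v u a env \<phi>] assms by simp

text \<open>Foundation applied to the singleton of \<open>x\<close>, which is cut out of a pairing
  set.\<close>

lemma irrefl: "\<not> E x x"
proof
  assume "E x x"
  obtain z where z: "E x z" using pairing by blast
  obtain b where b: "\<forall>y. E y b \<longleftrightarrow> E y z \<and> y = x"
    using separation[of z "\<lambda>_. x" 0 "FEq 0 1"] by auto
  then have "E x b" using z by blast
  then obtain y where "E y b" "\<And>z. E z y \<Longrightarrow> \<not> E z b" using foundation by blast
  then show False using b \<open>E x x\<close> by metis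
qed

lemma ex_upair: "\<exists>z. is_upair E z x y"
proof -
  obtain z where z: "E x z" "E y z" using pairing by blast
  have "\<exists>b. \<forall>w. E w b \<longleftrightarrow> E w z \<and> (w = x \<or> w = y)"
    using separation[of z "\<lambda>i. if i = 1 then x else y" 0 "FOr (FEq 0 1) (FEq 0 2)"] by auto
  with z show ?thesis unfolding is_upair_def by blast
qed

lemma upair_unique: "is_upair E z x y \<Longrightarrow> is_upair E z' x y \<Longrightarrow> z = z'"
  by (rule ext) (auto simp: is_upair_def)

lemma ex_opair: "\<exists>p. is_opair E p x y"
proof -
  obtain z1 where z1: "is_upair E z1 x x" using ex_upair by blast
  obtain z2 where z2: "is_upair E z2 x y" using ex_upair by blast
  obtain p where p: "is_upair E p z1 z2" using ex_upair by blast
  have "E z p \<longleftrightarrow> is_upair E z x x \<or> is_upair E z x y" for z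
    using p z1 z2 upair_unique unfolding is_upair_def[of E p] by metis
  then show ?thesis unfolding is_opair_def by blast
qed

lemma opair_unique: "is_opair E p x y \<Longrightarrow> is_opair E p' x y \<Longrightarrow> p = p'"
  by (rule ext) (auto simp: is_opair_def)

definition op :: "'m \<Rightarrow> 'm \<Rightarrow> 'm" where "op x y = (THE p. is_opair E p x y)"

lemma is_opair_iff [simp]: "is_opair E p x y \<longleftrightarrow> p = op x y"
proof -
  obtain q where q: "is_opair E q x y" using ex_opair by blast
  then have "op x y = q" unfolding op_def by (rule the_equality) (rule opair_unique[OF _ q])
  then show ?thesis using q opair_unique by blast
qed

lemma op_inject [simp]: "op x y = op x' y' \<longleftrightarrow> x = x' \<and> y = y'"
proof
  assume eq: "op x y = op x' y'"
  have "is_opair E (op x y) x y" "is_opair E (op x y) x' y'" using eq by simp_all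
  then have *: "is_upair E z x x \<or> is_upair E z x y \<longleftrightarrow> is_upair E z x' x' \<or> is_upair E z x' y'" for z
    unfolding is_opair_def by blast
  obtain z1 z2 z3 z4 where z: "is_upair E z1 x x" "is_upair E z2 x y" "is_upair E z3 x' x'" "is_upair E z4 x' y'"
    using ex_upair by meson
  have 1: "is_upair E z1 x' x' \<or> is_upair E z1 x' y'" and 2: "is_upair E z2 x' x' \<or> is_upair E z2 x' y'"
    and 4: "is_upair E z4 x x \<or> is_upair E z4 x y" using * z by blast+
  have "x' = x" using 1 z(1) unfolding is_upair_def by blast
  moreover have "E y z2" "E y' z4" using z unfolding is_upair_def by blast+
  then have "y = x' \<or> y = y'" "y' = x \<or> y' = y" using 2 4 unfolding is_upair_def by blast+
  then have "y = y'" using \<open>x' = x\<close> by auto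
  ultimately show "x = x' \<and> y = y'" by simp
qed simp

text \<open>Only a superset is produced, to serve as the ambient set for separation. In place of
  powerset, collection is applied twice: once to bound each row, once to gather the rows, whose
  union is then taken.\<close>

lemma ex_product: "\<exists>P. \<forall>x y. E x A \<longrightarrow> E y B \<longrightarrow> E (op x y) P"
proof -
  have row: "\<exists>Z. \<forall>x. E x A \<longrightarrow> E (op x y) Z" for y
    using collection[of 0 1 A "\<lambda>_. y" "FOpair 1 0 2"] by auto
  have "\<exists>Q. \<forall>y. E y B \<longrightarrow> (\<exists>Z. E Z Q \<and> (\<forall>x. E x A \<longrightarrow> E (op x y) Z))"
    using collection[of 0 1 B "\<lambda>_. A"
        "FAll 3 (FImp (FMem 3 2) (FEx 4 (FConj (FOpair 4 3 0) (FMem 4 1))))"] row by simp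
  then obtain Q where Q: "\<forall>y. E y B \<longrightarrow> (\<exists>Z. E Z Q \<and> (\<forall>x. E x A \<longrightarrow> E (op x y) Z))" by blast
  obtain P where "\<forall>y z. E z y \<longrightarrow> E y Q \<longrightarrow> E z P" using union by blast
  with Q show ?thesis by blast
qed

lemma ex_succ: "\<exists>s. is_succ E s x"
proof -
  obtain z where z: "is_upair E z x x" using ex_upair by blast
  obtain q where q: "E x q" "E z q" using pairing by blast
  obtain u where u: "\<forall>y z. E z y \<longrightarrow> E y q \<longrightarrow> E z u" using union by blast
  have "\<exists>b. \<forall>w. E w b \<longleftrightarrow> E w u \<and> (E w x \<or> w = x)"
    using separation[of u "\<lambda>_. x" 0 "FOr (FMem 0 1) (FEq 0 1)"] by auto
  with u q z show ?thesis unfolding is_succ_def is_upair_def by blast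
qed

definition S :: "'m \<Rightarrow> 'm" where "S x = (THE s. is_succ E s x)"

lemma is_succ_iff [simp]: "is_succ E s x \<longleftrightarrow> s = S x"
proof -
  have unique: "s = t" if "is_succ E s x" "is_succ E t x" for s t
    using that by (intro ext) (auto simp: is_succ_def)
  obtain q where q: "is_succ E q x" using ex_succ[of x] by blast
  then have "S x = q" unfolding S_def by (rule the_equality) (rule unique[OF _ q])
  then show ?thesis using q unique by blast
qed

lemma mem_S [simp]: "E z (S x) \<longleftrightarrow> E z x \<or> z = x"
proof -
  have "is_succ E (S x) x" by simp
  then show ?thesis unfolding is_succ_def by blast
qed

lemma ex_empty: "\<exists>e. is_empty E e"
  using infinity unfolding inductive_set_in_def by blast

definition zero :: 'm where "zero = (THE e. is_empty E e)"

lemma is_empty_iff [simp]: "is_empty E e \<longleftrightarrow> e = zero"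
proof -
  have unique: "s = t" if "is_empty E s" "is_empty E t" for s t
    using that by (intro ext) (auto simp: is_empty_def)
  obtain q where q: "is_empty E q" using ex_empty by blast
  then have "zero = q" unfolding zero_def by (rule the_equality) (rule unique[OF _ q])
  then show ?thesis using q unique by blast
qed

lemma not_mem_zero [simp]: "\<not> E z zero"
proof -
  have "is_empty E zero" by simp
  then show ?thesis unfolding is_empty_def by blast
qed

lemma inductive_set_iff: "inductive_set_in E w \<longleftrightarrow> E zero w \<and> (\<forall>x. E x w \<longrightarrow> E (S x) w)"
  unfolding inductive_set_in_def by auto

section \<open>The internal omega: induction, order and least elements\<close>

lemma ex_omega: "\<exists>w. is_omega E w"
proof -
  obtain w where w: "inductive_set_in E w" using infinity by blast
  let ?succ = "\<lambda>s x. FAll 5 (FIff (FMem 5 s) (FOr (FMem 5 x) (FEq 5 x)))"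
  let ?ind = "\<lambda>v. FConj (FEx 3 (FConj (FMem 3 v) (FAll 4 (FNeg (FMem 4 3)))))
     (FAll 3 (FImp (FMem 3 v) (FEx 4 (FConj (FMem 4 v) (?succ 4 3)))))"
  \<comment> \<open>The intersection of all inductive sets, separated from an arbitrary one; being
    in every inductive set is first-order.\<close>
  obtain b where b: "\<forall>x. E x b \<longleftrightarrow> E x w \<and> (\<forall>v. inductive_set_in E v \<longrightarrow> E x v)"
    using separation[of w "\<lambda>_. w" 0 "FAll 1 (FImp (?ind 1) (FMem 0 1))"]
    unfolding inductive_set_in_def is_succ_def is_empty_def by auto
  then have "inductive_set_in E b" using w by (simp add: inductive_set_iff)
  with b show ?thesis unfolding is_omega_def by blast
qed

definition om :: 'm where "om = (THE w. is_omega E w)"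

lemma is_omega_iff [simp]: "is_omega E w \<longleftrightarrow> w = om"
proof -
  have unique: "s = t" if "is_omega E s" "is_omega E t" for s t
    using that unfolding is_omega_def by (intro ext) blast
  obtain q where q: "is_omega E q" using ex_omega by blast
  then have "om = q" unfolding om_def by (rule the_equality) (rule unique[OF _ q])
  then show ?thesis using q unique by blast
qed

lemma omega_hat_eq: "omega_hat E = {x. E x om}"
  unfolding omega_hat_def by simp

lemma om_omega: "is_omega E om" by simp

lemma om_inductive: "inductive_set_in E om"
  using om_omega unfolding is_omega_def by (rule conjunct1)

lemma om_minimal: "inductive_set_in E v \<Longrightarrow> E x om \<Longrightarrow> E x v"
  using om_omega unfolding is_omega_def by blast

lemma zero_om [simp]: "E zero om" and S_om [simp]: "E x om \<Longrightarrow> E (S x) om"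
  using om_inductive by (simp_all add: inductive_set_iff)

text \<open>Since \<open>om\<close> may be nonstandard, induction holds only for predicates
  definable with parameters: separation makes the elements satisfying \<open>P\<close> an inductive
  set. Variable 0 of \<open>\<phi>\<close> is the induction variable, and the other free variables
  read their parameters from \<open>env\<close>.\<close>

lemma om_induct:
  assumes "E n om" "\<And>x. sat E (env(0 := x)) \<phi> \<longleftrightarrow> P x"
    and "P zero" "\<And>x. E x om \<Longrightarrow> P x \<Longrightarrow> P (S x)"
  shows "P n"
proof -
  obtain b where b: "\<forall>x. E x b \<longleftrightarrow> E x om \<and> P x"
    using separation[of om env 0 \<phi>] assms(2) by auto
  then have "inductive_set_in E b" using assms(3,4) by (simp add: inductive_set_iff)
  then show ?thesis using om_minimal assms(1) b by blast
qed

lemma om_subset: "E n om \<Longrightarrow> E x n \<Longrightarrow> E x om"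
proof -
  assume "E n om" "E x n"
  have "\<forall>x. E x n \<longrightarrow> E x om"
    by (rule om_induct[OF \<open>E n om\<close>, where env = "\<lambda>_. om" and \<phi> = "FAll 1 (FImp (FMem 1 0) (FMem 1 2))"]) auto
  then show ?thesis using \<open>E x n\<close> by blast
qed

lemma om_trans: "E n om \<Longrightarrow> E y n \<Longrightarrow> E x y \<Longrightarrow> E x n"
proof -
  assume n: "E n om" and a: "E y n" "E x y"
  have "\<forall>y x. E y n \<longrightarrow> E x y \<longrightarrow> E x n"
    by (rule om_induct[OF n, where env = "\<lambda>_. om" and
          \<phi> = "FAll 1 (FAll 2 (FImp (FMem 1 0) (FImp (FMem 2 1) (FMem 2 0))))"]) auto
  then show ?thesis using a by blast
qed

lemma zero_le: assumes "E n om" shows "n = zero \<or> E zero n"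
  by (rule om_induct[OF assms, where P = "\<lambda>n. n = zero \<or> E zero n" and env = "\<lambda>_. zero" and \<phi> = "FOr (FEq 0 1) (FMem 1 0)"]) auto

lemma S_le: assumes "E n om" "E m n" shows "S m = n \<or> E (S m) n"
proof -
  have "E m n \<longrightarrow> S m = n \<or> E (S m) n"
    by (rule om_induct[OF assms(1), where P = "\<lambda>n. E m n \<longrightarrow> S m = n \<or> E (S m) n" and env = "\<lambda>i. if i = 1 then m else S m" and
        \<phi> = "FImp (FMem 1 0) (FOr (FEq 2 0) (FMem 2 0))"]) auto
  then show ?thesis using assms by blast
qed

lemma om_linear:
  assumes "E m om" "E n om" shows "E m n \<or> m = n \<or> E n m"
proof (rule om_induct[OF assms(1), where P = "\<lambda>m. E m n \<or> m = n \<or> E n m" and env = "\<lambda>_. n" and \<phi> = "FOr (FMem 0 1) (FOr (FEq 0 1) (FMem 1 0))"])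
  show "E zero n \<or> zero = n \<or> E n zero" using zero_le[OF assms(2)] by auto
next
  fix x assume "E x om" "E x n \<or> x = n \<or> E n x"
  then show "E (S x) n \<or> S x = n \<or> E n (S x)" using S_le[OF assms(2)] by auto
qed simp

text \<open>Foundation gives a membership-minimal element of the separated set, and linearity makes
  it least. This is the source of all overspill arguments below: a definable set has a least
  element, whereas the two sides of a gap have no end points.\<close>

lemma om_least:
  assumes "E x om" "P x" "\<And>x. sat E (env(0 := x)) \<phi> \<longleftrightarrow> P x"
  obtains y where "E y om" "P y" "\<And>z. E z om \<Longrightarrow> P z \<Longrightarrow> z = y \<or> E y z"
proof -
  obtain b where b: "\<forall>x. E x b \<longleftrightarrow> E x om \<and> P x"
    using separation[of om env 0 \<phi>] assms(3) by auto
  then obtain y where "E y b" "\<And>z. E z y \<Longrightarrow> \<not> E z b" using foundation assms by metis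
  then show ?thesis using that b om_linear by metis
qed

text \<open>If \<open>x\<close> were not a successor, \<open>om\<close> without \<open>x\<close>
  would still be inductive.\<close>

lemma ex_pred: assumes "E x om" "x \<noteq> zero" obtains y where "E y om" "x = S y"
proof -
  obtain b where b: "\<forall>z. E z b \<longleftrightarrow> E z om \<and> z \<noteq> x"
    using separation[of om "\<lambda>_. x" 0 "FNeg (FEq 0 1)"] by auto
  have "\<not> inductive_set_in E b"
    using om_minimal assms(1) b by blast
  then have "\<exists>y. E y om \<and> x = S y" using b assms(2) unfolding inductive_set_iff by auto
  with that show ?thesis by blast
qed

text \<open>The intended graph is that of \<open>x\<close> mapped to \<open>n - 1 - x\<close>. Its
  existence is a first-order property of \<open>n\<close>, so internal induction applies: passing
  from \<open>n\<close> to \<open>S n\<close> raises all old values by one and adds the pair of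
  \<open>n\<close> and \<open>zero\<close>.\<close>

lemma ex_reversal:
  assumes "E n om"
  shows "\<exists>g. (\<forall>x. E x n \<longrightarrow> (\<exists>y. E y om \<and> E (op x y) g)) \<and>
     (\<forall>x y x' y'. E x x' \<longrightarrow> E (op x y) g \<longrightarrow> E (op x' y') g \<longrightarrow> E y' y) \<and>
     (\<forall>p. E p g \<longrightarrow> (\<exists>x y. p = op x y \<and> E x n \<and> E y om))" (is "?P n")
\<comment> \<open>Under the constant assignment, variable 50 denotes \<open>om\<close>.\<close>
proof (rule om_induct[OF assms, of "\<lambda>_. om" "FEx 1 (FConj (FConj
      (FAll 2 (FImp (FMem 2 0) (FEx 3 (FConj (FMem 3 50) (FEx 4 (FConj (FOpair 4 2 3) (FMem 4 1)))))))
      (FAll 2 (FAll 3 (FAll 4 (FAll 5 (FImp (FMem 2 4) (FImp (FEx 6 (FConj (FOpair 6 2 3) (FMem 6 1)))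
         (FImp (FEx 6 (FConj (FOpair 6 4 5) (FMem 6 1))) (FMem 5 3)))))))))
      (FAll 2 (FImp (FMem 2 1) (FEx 3 (FEx 4 (FConj (FOpair 2 3 4) (FConj (FMem 3 0) (FMem 4 50))))))))"])
  show "?P zero" by (rule exI[of _ zero]) simp
next
  fix n assume n: "E n om" and "?P n"
  then obtain g where g: "\<forall>x. E x n \<longrightarrow> (\<exists>y. E y om \<and> E (op x y) g)"
    "\<forall>x y x' y'. E x x' \<longrightarrow> E (op x y) g \<longrightarrow> E (op x' y') g \<longrightarrow> E y' y"
    "\<forall>p. E p g \<longrightarrow> (\<exists>x y. p = op x y \<and> E x n \<and> E y om)" by (elim exE conjE)
  have g1: "\<exists>y. E y om \<and> E (op x y) g" if "E x n" for x using g(1) that by blast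
  have g2: "E y' y" if "E x x'" "E (op x y) g" "E (op x' y') g" for x y x' y' using g(2) that by blast
  have g3: "E x n \<and> E y om" if "E (op x y) g" for x y using g(3) that by force
  obtain W where W: "\<forall>x y. E x om \<longrightarrow> E y om \<longrightarrow> E (op x y) W" using ex_product by blast
  obtain g' where g': "\<forall>p. E p g' \<longleftrightarrow> E p W \<and> (p = op n zero \<or> (\<exists>x y. E (op x y) g \<and> p = op x (S y)))"
    using separation[of W "\<lambda>i. if i = 1 then op n zero else g" 0
       "FOr (FEq 0 1) (FEx 3 (FEx 4 (FConj (FEx 5 (FConj (FOpair 5 3 4) (FMem 5 2)))
         (FEx 6 (FConj (FAll 7 (FIff (FMem 7 6) (FOr (FMem 7 4) (FEq 7 4)))) (FOpair 0 3 6))))))"]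
    by (auto simp flip: is_succ_def)
  have mem: "E (op x y) g' \<longleftrightarrow> x = n \<and> y = zero \<or> (\<exists>z. y = S z \<and> E (op x z) g)" for x y
    using g' W g3 n om_subset[OF n] by auto
  show "?P (S n)"
  proof (rule exI[of _ g'], intro conjI allI impI)
    fix x assume "E x (S n)"
    then consider "x = n" | y where "E y om" "E (op x y) g" using g1[of x] by auto
    then show "\<exists>y. E y om \<and> E (op x y) g'" 
    proof cases
      case 1
      then show ?thesis using mem zero_om by blast
    next
      case 2
      then show ?thesis using mem S_om by blast
    qed
  next
    fix x y x' y' assume a: "E x x'" "E (op x y) g'" "E (op x' y') g'"
    from a(3) consider "x' = n" "y' = zero" | z' where "y' = S z'" "E (op x' z') g" by (auto simp: mem)
    then show "E y' y"
    proof cases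
      case 1
      then have "x \<noteq> n" using a irrefl by blast
      then obtain z where "y = S z" "E (op x z) g" using a(2) mem by blast
      then show ?thesis using 1 zero_le[of "S z"] g3 by (metis S_om mem_S not_mem_zero)
    next
      case 2
      have "x \<noteq> n" using a(1) g3[OF 2(2)] om_trans[OF n] irrefl by blast
      then obtain z where z: "y = S z" "E (op x z) g" using a(2) mem by blast
      then have "E z' z" using g2[OF a(1)] 2 by blast
      then show ?thesis using S_le g3[OF z(2)] 2 z by auto
    qed
  next
    fix p assume "E p g'"
    then show "\<exists>x y. p = op x y \<and> E x (S n) \<and> E y om" using g' g3 by auto
  qed
qed (auto)

section \<open>Reflecting cuts\<close>

lemma om_asym: "E y om \<Longrightarrow> E x y \<Longrightarrow> \<not> E y x"
  using om_trans irrefl by blast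

text \<open>The external choice \<open>h\<close> of values is convenient for transporting sequences,
  while the internal graph \<open>g\<close> can occur as a parameter in formulas.\<close>

lemma ex_antitone:
  assumes n: "E n om"
  obtains g h where "\<And>x. E x n \<Longrightarrow> E (h x) om"
    "\<And>x. E x n \<Longrightarrow> E (op x (h x)) g"
    "\<And>x y x' y'. E x x' \<Longrightarrow> E (op x y) g \<Longrightarrow> E (op x' y') g \<Longrightarrow> E y' y"
    "\<And>x x'. E x' n \<Longrightarrow> E x x' \<Longrightarrow> E (h x') (h x)"
proof -
  obtain g where g: "\<forall>x. E x n \<longrightarrow> (\<exists>y. E y om \<and> E (op x y) g)"
    "\<forall>x y x' y'. E x x' \<longrightarrow> E (op x y) g \<longrightarrow> E (op x' y') g \<longrightarrow> E y' y"
    using ex_reversal[OF n] by (elim exE conjE)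
  then obtain h where h: "\<forall>x. E x n \<longrightarrow> E (h x) om \<and> E (op x (h x)) g" by metis
  show thesis
  proof (rule that[of h g])
    show "E (h x') (h x)" if "E x' n" "E x x'" for x x'
      using g(2) h that om_trans[OF n that] by blast
  qed (use g h in blast)+
qed

lemma has_cutI:
  assumes "\<And>i. i \<in> Field r \<Longrightarrow> E (a i) om" "\<And>j. j \<in> Field s \<Longrightarrow> E (b j) om"
    and "\<And>i i'. (i, i') \<in> r \<Longrightarrow> i \<noteq> i' \<Longrightarrow> E (a i) (a i')"
    and "\<And>j j'. (j, j') \<in> s \<Longrightarrow> j \<noteq> j' \<Longrightarrow> E (b j') (b j)"
    and "\<And>i j. i \<in> Field r \<Longrightarrow> j \<in> Field s \<Longrightarrow> E (a i) (b j)"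
    and gap: "\<And>c. E c om \<Longrightarrow> \<forall>i\<in>Field r. E (a i) c \<Longrightarrow> \<forall>j\<in>Field s. E c (b j) \<Longrightarrow> False"
  shows "has_cut E r s"
proof -
  have "\<not> (\<exists>c\<in>{x. E x om}. (\<forall>i\<in>Field r. E (a i) c) \<and> (\<forall>j\<in>Field s. E c (b j)))"
    using gap by blast
  then show ?thesis
    unfolding has_cut_def omega_hat_eq
    by (intro exI[of _ a] exI[of _ b] conjI) (simp_all add: assms(1-5))
qed

lemma has_cutE:
  assumes "has_cut E r s"
  obtains a b where "\<forall>i\<in>Field r. E (a i) om" "\<forall>j\<in>Field s. E (b j) om"
    "\<forall>i i'. (i, i') \<in> r \<longrightarrow> i \<noteq> i' \<longrightarrow> E (a i) (a i')"
    "\<forall>j j'. (j, j') \<in> s \<longrightarrow> j \<noteq> j' \<longrightarrow> E (b j') (b j)"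
    "\<forall>i\<in>Field r. \<forall>j\<in>Field s. E (a i) (b j)"
    "\<not> (\<exists>c. E c om \<and> (\<forall>i\<in>Field r. E (a i) c) \<and> (\<forall>j\<in>Field s. E c (b j)))"
proof -
  show thesis using assms unfolding has_cut_def omega_hat_eq mem_Collect_eq Bex_def
    by (elim exE conjE) (rule that)
qed

text \<open>Both sequences are pushed through the order-reversing \<open>h\<close>. A point filling
  the reflected gap would pull back along the graph \<open>g\<close> to a point filling the original
  one.\<close>

lemma has_cut_swap:
  assumes r: "Card_order r" "infinite (Field r)" and s: "Card_order s" "infinite (Field s)"
    and cut: "has_cut E r s"
  shows "has_cut E s r"
proof -
  obtain a b where a: "\<forall>i\<in>Field r. E (a i) om" and b: "\<forall>j\<in>Field s. E (b j) om"
    and inc: "\<forall>i i'. (i, i') \<in> r \<longrightarrow> i \<noteq> i' \<longrightarrow> E (a i) (a i')"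
    and dec: "\<forall>j j'. (j, j') \<in> s \<longrightarrow> j \<noteq> j' \<longrightarrow> E (b j') (b j)"
    and ab: "\<forall>i\<in>Field r. \<forall>j\<in>Field s. E (a i) (b j)"
    and gap: "\<not> (\<exists>c. E c om \<and> (\<forall>i\<in>Field r. E (a i) c) \<and> (\<forall>j\<in>Field s. E c (b j)))"
    using cut by (rule has_cutE)
  have "Field s \<noteq> {}" using s(2) by auto
  \<comment> \<open>The first index: \<open>b j0\<close> is the largest term, so
    \<open>S (b j0)\<close> bounds the whole cut and the reversal need only be defined below
    it.\<close>
  then obtain j0 where j0: "j0 \<in> Field s" "\<forall>j. (j, j0) \<in> s - Id \<longrightarrow> j \<notin> Field s"
    using wf_strict_Card_order[OF s(1)] unfolding wf_eq_minimal by (metis ex_in_conv)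
  have le: "b j = b j0 \<or> E (b j) (b j0)" if "j \<in> Field s" for j
    using card_order_cases[OF s(1) that j0(1)] j0(2) that dec by auto
  define n where "n = S (b j0)"
  have n: "E n om" using b j0(1) by (simp add: n_def)
  have bn: "E (b j) n" if "j \<in> Field s" for j using le[OF that] unfolding n_def by auto
  have an: "E (a i) n" if "i \<in> Field r" for i using ab that j0(1) unfolding n_def by auto
  obtain g h where h: "\<And>x. E x n \<Longrightarrow> E (h x) om"
    and hg: "\<And>x. E x n \<Longrightarrow> E (op x (h x)) g"
    and g: "\<And>x y x' y'. E x x' \<Longrightarrow> E (op x y) g \<Longrightarrow> E (op x' y') g \<Longrightarrow> E y' y"
    and anti: "\<And>x x'. E x' n \<Longrightarrow> E x x' \<Longrightarrow> E (h x') (h x)"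
    by (rule ex_antitone[OF n]) (rule that)
  have no_gap: False
    if c: "E c om" "\<And>j. j \<in> Field s \<Longrightarrow> E (h (b j)) c" "\<And>i. i \<in> Field r \<Longrightarrow> E c (h (a i))" for c
  proof -
    \<comment> \<open>The points with a reflected value at most \<open>c\<close>, phrased with
      \<open>g\<close> and not \<open>h\<close> so that the set is definable and has a least element
      \<open>x\<close>. This \<open>x\<close> lands in the original gap.\<close>
    let ?P = "\<lambda>x. \<exists>y. E (op x y) g \<and> (E y c \<or> y = c)"
    have P_b: "?P (b j)" if "j \<in> Field s" for j using c(2) hg bn that by blast
    obtain x where x: "E x om" "?P x" "\<And>z. E z om \<Longrightarrow> ?P z \<Longrightarrow> z = x \<or> E x z"
    proof (rule om_least[where P = ?P])
      show "E (b j0) om" using b j0 by blast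
      show "?P (b j0)" using P_b j0 by blast
      show "sat E ((\<lambda>i. if i = 3 then g else c)(0 := x)) (FEx 1 (FConj (FEx 2 (FConj (FOpair 2 0 1) (FMem 2 3)))
          (FOr (FMem 1 4) (FEq 1 4)))) \<longleftrightarrow> ?P x" for x by auto
    qed blast
    obtain y where y: "E (op x y) g" "E y c \<or> y = c" using x(2) by blast
    have "E (a i) x" if i: "i \<in> Field r" for i
    proof (rule ccontr)
      assume "\<not> E (a i) x"
      then have *: "x = a i \<or> E x (a i)" using om_linear a i x(1) by blast
      \<comment> \<open>A later index makes the inequality strict, as \<open>x\<close> could equal
        \<open>a i\<close>.\<close>
      obtain i' where i': "i' \<in> Field r" "i \<noteq> i'" "(i, i') \<in> r"
        using infinite_Card_order_limit[OF r i] by blast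
      have "E x (a i')" using * inc i' a om_trans by blast
      then have "E (h (a i')) y" using g y(1) hg an i'(1) by blast
      then have "E (h (a i')) c" using y(2) om_trans c(1) by blast
      then show False using c(1) c(3)[OF i'(1)] om_asym by blast
    qed
    moreover have "E x (b j)" if j: "j \<in> Field s" for j
    proof -
      obtain j' where j': "j' \<in> Field s" "j \<noteq> j'" "(j, j') \<in> s"
        using infinite_Card_order_limit[OF s j] by blast
      then have "b j' = x \<or> E x (b j')" using x(3) P_b b by blast
      then show ?thesis using dec j' b om_trans j by blast
    qed
    ultimately show False using gap x(1) by blast
  qed
  show ?thesis
  proof (rule has_cutI[where a = "\<lambda>j. h (b j)" and b = "\<lambda>i. h (a i)"])
    show "E (h (b j)) (h (b j'))" if "(j, j') \<in> s" "j \<noteq> j'" for j j'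
      using anti dec bn that by (metis FieldI1)
    show "E (h (a i')) (h (a i))" if "(i, i') \<in> r" "i \<noteq> i'" for i i'
      using anti inc an that by (metis FieldI2)
    show False if "E c om" "\<forall>j\<in>Field s. E (h (b j)) c" "\<forall>i\<in>Field r. E c (h (a i))" for c
      using no_gap that by blast
  qed (use h an bn anti ab in blast)+
qed

section \<open>Interpolating two sequences by an internal function\<close>

abbreviation le where "le x y \<equiv> E x y \<or> x = y"

text \<open>These are the nodes of the path: internal functions from \<open>[0, A0]\<close> to
  \<open>[0, A1]\<close> sending \<open>A0\<close> to \<open>A1\<close>. Monotonicity is not part of
  the condition; control of the range is what the cut argument uses.\<close>

definition approximant where
  "approximant A0 A1 c \<longleftrightarrow>
     (\<forall>p. E p c \<longrightarrow> (\<exists>x y. p = op x y \<and> le x A0 \<and> le y A1)) \<and>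
     (\<forall>x. le x A0 \<longrightarrow> (\<exists>y. E (op x y) c)) \<and>
     (\<forall>x y y'. E (op x y) c \<longrightarrow> E (op x y') c \<longrightarrow> y = y') \<and>
     E (op A0 A1) c"

text \<open>Truncating the values of \<open>u\<close> at \<open>A1\<close> makes an arbitrary upper bound in the tree reusable at
  limit stages.\<close>

lemma ex_approximant:
  assumes A: "E A0 om" "E A1 om" and func: "\<And>x y y'. E (op x y) u \<Longrightarrow> E (op x y') u \<Longrightarrow> y = y'"
  shows "\<exists>c. approximant A0 A1 c
    \<and> (\<forall>x y. E (op x y) u \<longrightarrow> E x A0 \<longrightarrow> le y A1 \<longrightarrow> E (op x y) c)"
proof -
  obtain W where W: "\<forall>x y. E x om \<longrightarrow> E y om \<longrightarrow> E (op x y) W" using ex_product by blast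
  \<comment> \<open>Below \<open>A0\<close> a value of \<open>u\<close> is kept if it is at most
    \<open>A1\<close>. Every other argument, including \<open>A0\<close> itself, receives the
    default value \<open>A1\<close>.\<close>
  define K where "K x y \<longleftrightarrow> le x A0 \<and> le y A1 \<and>
     (E (op x y) u \<and> x \<noteq> A0 \<or> y = A1 \<and> \<not> (x \<noteq> A0 \<and> (\<exists>y'. le y' A1 \<and> E (op x y') u)))" for x y
  obtain c where c: "\<forall>p. E p c \<longleftrightarrow> E p W \<and> sat E ((\<lambda>i. if i = 1 then u else if i = 2 then A0 else A1)(0 := p))
     (FEx 4 (FEx 5 (FConj (FOpair 0 4 5) (FConj (FOr (FMem 4 2) (FEq 4 2)) (FConj (FOr (FMem 5 3) (FEq 5 3))
      (FOr (FConj (FMem 0 1) (FNeg (FEq 4 2)))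
       (FConj (FEq 5 3) (FNeg (FConj (FNeg (FEq 4 2)) (FEx 6 (FConj (FOr (FMem 6 3) (FEq 6 3))
         (FEx 7 (FConj (FOpair 7 4 6) (FMem 7 1))))))))))))))"
    using separation by blast
  then have c: "E p c \<longleftrightarrow> E p W \<and> (\<exists>x y. p = op x y \<and> K x y)" for p
    unfolding K_def by auto
  have "le x A0 \<Longrightarrow> le y A1 \<Longrightarrow> E (op x y) W" for x y using W A om_subset by metis
  then have mem: "E (op x y) c \<longleftrightarrow> K x y" for x y using c unfolding K_def by auto
  have "approximant A0 A1 c" unfolding approximant_def
  proof (intro conjI allI impI)
    show "\<exists>x y. p = op x y \<and> le x A0 \<and> le y A1" if "E p c" for p
      using that c unfolding K_def by blast
    show "\<exists>y. E (op x y) c" if "le x A0" for x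
      using that unfolding mem K_def by blast
    show "y = y'" if "E (op x y) c" "E (op x y') c" for x y y'
      using that func unfolding mem K_def by blast
    show "E (op A0 A1) c" unfolding mem K_def by blast
  qed
  moreover have "E (op x y) c" if "E (op x y) u" "E x A0" "le y A1" for x y
    using that irrefl unfolding mem K_def by blast
  ultimately show ?thesis by blast
qed

lemma approximant_total:
  assumes "approximant A0 A1 c" "le x A0"
  shows "\<exists>y. le y A1 \<and> E (op x y) c"
proof -
  have total: "\<forall>x. le x A0 \<longrightarrow> (\<exists>y. E (op x y) c)"
    using assms(1) unfolding approximant_def by (elim conjE)
  have range: "\<forall>p. E p c \<longrightarrow> (\<exists>x y. p = op x y \<and> le x A0 \<and> le y A1)"
    using assms(1) unfolding approximant_def by (elim conjE)
  obtain y where y: "E (op x y) c" using total assms(2) by blast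
  then obtain x' y' where "op x y = op x' y'" "le y' A1" using range by blast
  then show ?thesis using y by (metis op_inject)
qed

text \<open>The domain \<open>[0, A0]\<close> is the internal number \<open>S A0\<close>, which is
  therefore the length that has to be below \<open>n\<close>.\<close>

lemma approximant_is_seq:
  assumes "approximant A0 A1 c" "E n om" "E (S A0) n" "E A1 n"
  shows "is_seq E n c"
proof -
  have "E y n" if "le y A1" for y using that assms om_trans by blast
  then show ?thesis using assms(1,3)
    unfolding is_seq_def approximant_def is_opair_iff
    by (intro exI[of _ "S A0"]) (auto; metis)
qed

text \<open>The pair of \<open>B0\<close> and \<open>B1\<close> separates the two functions, since
  \<open>B0\<close> lies beyond the domain of \<open>c\<close>.\<close>

lemma approximant_strict:
  assumes "approximant A0 A1 c" "approximant B0 B1 d" "E B0 om" "E A0 B0" "\<And>p. E p c \<Longrightarrow> E p d"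
  shows "seq_less E c d"
proof -
  have "E (op B0 B1) d" using assms(2) unfolding approximant_def by blast
  moreover have "\<not> E (op B0 B1) c"
  proof
    assume "E (op B0 B1) c"
    then have "le B0 A0" using assms(1) unfolding approximant_def by (metis op_inject)
    then show False using assms(3,4) om_asym irrefl by blast
  qed
  ultimately show ?thesis using assms(5) unfolding seq_less_def by blast
qed

text \<open>Recursion along \<open>\<kappa>\<close> yields approximants increasing under inclusion.
  Each stage first finds an internal function above all earlier ones and then truncates it;
  \<open>below_t\<close> supplies this function at limits and once more for the complete
  path.\<close>

lemma ex_interpolation:
  fixes \<kappa> :: "'k rel"
  assumes \<kappa>: "Card_order \<kappa>" "infinite (Field \<kappa>)" and t: "below_t E \<kappa>" and n: "E n om"
    and a0: "\<And>i. i \<in> Field \<kappa> \<Longrightarrow> E (S (a0 i)) n" and a1: "\<And>i. i \<in> Field \<kappa> \<Longrightarrow> E (a1 i) n"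
    and inc0: "\<And>i j. (i, j) \<in> \<kappa> \<Longrightarrow> i \<noteq> j \<Longrightarrow> E (a0 i) (a0 j)"
    and inc1: "\<And>i j. (i, j) \<in> \<kappa> \<Longrightarrow> i \<noteq> j \<Longrightarrow> E (a1 i) (a1 j)"
  shows "\<exists>u. (\<forall>x y y'. E (op x y) u \<longrightarrow> E (op x y') u \<longrightarrow> y = y') \<and>
     (\<forall>i\<in>Field \<kappa>. E (op (a0 i) (a1 i)) u \<and> (\<forall>x. le x (a0 i) \<longrightarrow> (\<exists>y. le y (a1 i) \<and> E (op x y) u)))"
proof -
  have om0: "E (a0 i) om" and om1: "E (a1 i) om" if "i \<in> Field \<kappa>" for i
    using om_trans[OF n a0[OF that], of "a0 i"] om_subset[OF n] a1[OF that] by auto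
  have field: "i \<in> Field \<kappa>" "j \<in> Field \<kappa>" if "(i, j) \<in> \<kappa> - Id" for i j
    using that by (auto simp: Field_def)
  have tr: "(i, k) \<in> \<kappa> - Id" if "(i, j) \<in> \<kappa> - Id" "(j, k) \<in> \<kappa> - Id" for i j k
    using that Card_order_trans[OF \<kappa>(1)] by blast
  \<comment> \<open>An upper bound in the tree is itself an internal function and contains every
    node of the path.\<close>
  have bounded: "\<exists>u. (\<forall>x y y'. E (op x y) u \<longrightarrow> E (op x y') u \<longrightarrow> y = y') \<and> (\<forall>k\<in>Field \<mu>. \<forall>p. E p (f k) \<longrightarrow> E p u)"
    if \<mu>: "Card_order \<mu>" "infinite (Field \<mu>)" "\<mu> \<le>o \<kappa>"
      and f: "\<forall>k\<in>Field \<mu>. is_seq E n (f k)" "\<forall>k l. (k, l) \<in> \<mu> \<longrightarrow> k \<noteq> l \<longrightarrow> seq_less E (f k) (f l)"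
    for \<mu> :: "'k rel" and f
  proof -
    have "\<not> unbounded_seq (seq_tree E n) (seq_less E) \<mu>"
      using t n \<mu> unfolding below_t_def omega_hat_eq by blast
    then obtain u where u: "is_seq E n u" "\<forall>k\<in>Field \<mu>. seq_less E (f k) u"
      using f unfolding unbounded_seq_def seq_tree_def by blast
    then have "E (op x y) u \<Longrightarrow> E (op x y') u \<Longrightarrow> y = y'" for x y y'
      unfolding is_seq_def is_opair_iff by blast
    then show ?thesis using u(2) unfolding seq_less_def by blast
  qed
  \<comment> \<open>The condition at \<open>i\<close> reads \<open>f\<close> only at smaller
    indices, as dependent choice along a well-founded relation requires.\<close>
  define Q where "Q f i c \<longleftrightarrow> (i \<in> Field \<kappa> \<longrightarrow> approximant (a0 i) (a1 i) c \<and>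
     (\<forall>j. (j, i) \<in> \<kappa> - Id \<longrightarrow> (\<forall>p. E p (f j) \<longrightarrow> E p c)))" for f i c
  have Q_seq: "is_seq E n c" if "Q f i c" "i \<in> Field \<kappa>" for f i c
    using that approximant_is_seq n a0 a1 unfolding Q_def by blast
  have Q_less: "seq_less E (f i) (f j)" if "Q f i (f i)" "Q f j (f j)" "(i, j) \<in> \<kappa> - Id" for f i j
    using that field[OF that(3)] om0 inc0 unfolding Q_def
    by (intro approximant_strict[of "a0 i" "a1 i" "f i" "a0 j" "a1 j" "f j"]) auto
  have "\<exists>f. \<forall>i. Q f i (f i)"
  proof (rule dependent_wf_choice)
    show "wf (\<kappa> - Id)" using \<kappa>(1) by (rule wf_strict_Card_order)
  next
    show "Q f i c = Q f' i c" if "\<And>j. (j, i) \<in> \<kappa> - Id \<Longrightarrow> f j = f' j" for f f' i c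
      using that unfolding Q_def by auto
  next
    fix i f assume prev: "\<And>j. (j, i) \<in> \<kappa> - Id \<Longrightarrow> Q f j (f j)"
    show "\<exists>c. Q f i c"
    proof (cases "i \<in> Field \<kappa>")
      case i: True
      have "\<exists>u. (\<forall>x y y'. E (op x y) u \<longrightarrow> E (op x y') u \<longrightarrow> y = y') \<and> (\<forall>j. (j, i) \<in> \<kappa> - Id \<longrightarrow> (\<forall>p. E p (f j) \<longrightarrow> E p u))"
      \<comment> \<open>If there is a last predecessor, its function already contains all earlier
        ones. With no predecessor at all, the empty set will do. Otherwise \<open>i\<close> is a
        limit.\<close>
      proof (cases "\<exists>j. (j, i) \<in> \<kappa> - Id \<and> (\<forall>k. (k, i) \<in> \<kappa> - Id \<longrightarrow> k = j \<or> (k, j) \<in> \<kappa> - Id)")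
        case True
        then obtain j where j: "(j, i) \<in> \<kappa> - Id" "\<And>k. (k, i) \<in> \<kappa> - Id \<Longrightarrow> k = j \<or> (k, j) \<in> \<kappa> - Id"
          by blast
        have Qj: "Q f j (f j)" "j \<in> Field \<kappa>" using prev[OF j(1)] field[OF j(1)] by auto
        show ?thesis
        proof (intro exI[of _ "f j"] conjI)
          show "\<forall>x y y'. E (op x y) (f j) \<longrightarrow> E (op x y') (f j) \<longrightarrow> y = y'"
            using Qj unfolding Q_def approximant_def by blast
          show "\<forall>k. (k, i) \<in> \<kappa> - Id \<longrightarrow> (\<forall>p. E p (f k) \<longrightarrow> E p (f j))"
            using j(2) Qj unfolding Q_def by blast
        qed
      next
        case no_max: False
        show ?thesis
        proof (cases "underS \<kappa> i = {}")
          case True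
          then have "\<not> (j, i) \<in> \<kappa> - Id" for j unfolding underS_def by blast
          then show ?thesis by (intro exI[of _ zero]) auto
        next
          case nonempty: False
          have in_U: "j \<in> underS \<kappa> i \<longleftrightarrow> (j, i) \<in> \<kappa> - Id" for j unfolding underS_def by auto
          \<comment> \<open>Reversing the order turns a coinitial sequence into an increasing one
            cofinal below \<open>i\<close>. Its index cardinal lives on a subset of
            \<open>Field \<kappa>\<close>, so it is at most \<open>\<kappa>\<close> and
            \<open>below_t\<close> applies to it.\<close>
          obtain \<mu> s where \<mu>: "Card_order \<mu>" "infinite (Field \<mu>)" "Field \<mu> \<subseteq> underS \<kappa> i"
            and s: "\<And>k. k \<in> Field \<mu> \<Longrightarrow> s k \<in> underS \<kappa> i"
              "\<And>k l. (k, l) \<in> \<mu> \<Longrightarrow> k \<noteq> l \<Longrightarrow> (s k, s l) \<in> \<kappa> - Id"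
              "\<And>j. j \<in> underS \<kappa> i \<Longrightarrow> \<exists>k\<in>Field \<mu>. (j, s k) \<in> \<kappa> - Id"
          proof (rule coinitial_sequence[of "underS \<kappa> i" "\<lambda>x y. (y, x) \<in> \<kappa> - Id"])
            have total: "x = y \<or> (x, y) \<in> \<kappa> - Id \<or> (y, x) \<in> \<kappa> - Id" if "x \<in> underS \<kappa> i" "y \<in> underS \<kappa> i" for x y
              using card_order_cases[OF \<kappa>(1)] that field unfolding in_U by blast
            then show "(y, x) \<in> \<kappa> - Id \<or> x = y \<or> (x, y) \<in> \<kappa> - Id" if "x \<in> underS \<kappa> i" "y \<in> underS \<kappa> i" for x y
              using that by blast
            show "\<exists>y\<in>underS \<kappa> i. (x, y) \<in> \<kappa> - Id" if x: "x \<in> underS \<kappa> i" for x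
            proof -
              have "(x, i) \<in> \<kappa> - Id" using x unfolding in_U .
              then obtain k where k: "(k, i) \<in> \<kappa> - Id" "k \<noteq> x" "(k, x) \<notin> \<kappa> - Id"
                using no_max by metis
              then have "k \<in> underS \<kappa> i" using in_U by simp
              then show ?thesis using total[OF x] k(2,3) by metis
            qed
            show "(z, x) \<in> \<kappa> - Id" if "(y, x) \<in> \<kappa> - Id" "(z, y) \<in> \<kappa> - Id" for x y z
              using tr that by blast
          qed (simp, simp add: nonempty, rule that)
          have "Field \<mu> \<subseteq> Field \<kappa>" using \<mu>(3) field unfolding in_U subset_iff by blast
          then have "\<mu> \<le>o \<kappa>"
            using card_of_mono1 card_of_Field_ordIso[OF \<mu>(1)] card_of_Field_ordIso[OF \<kappa>(1)]
            by (meson ordIso_ordLeq_trans ordIso_symmetric ordLeq_ordIso_trans)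
          moreover have "is_seq E n (f (s k))" if "k \<in> Field \<mu>" for k
            using s(1)[OF that] Q_seq prev field unfolding in_U by blast
          moreover have "seq_less E (f (s k)) (f (s l))" if "(k, l) \<in> \<mu>" "k \<noteq> l" for k l
          proof -
            have "(s k, i) \<in> \<kappa> - Id" "(s l, i) \<in> \<kappa> - Id"
              using s(1) that FieldI1 FieldI2 unfolding in_U by metis+
            then show ?thesis using Q_less prev s(2)[OF that] by blast
          qed
          ultimately obtain u where u: "\<forall>x y y'. E (op x y) u \<longrightarrow> E (op x y') u \<longrightarrow> y = y'"
            "\<forall>k\<in>Field \<mu>. \<forall>p. E p (f (s k)) \<longrightarrow> E p u"
            using bounded[OF \<mu>(1,2), of "\<lambda>k. f (s k)"] by blast
          have "E p u" if j: "(j, i) \<in> \<kappa> - Id" and p: "E p (f j)" for j p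
          proof -
            obtain k where k: "k \<in> Field \<mu>" "(j, s k) \<in> \<kappa> - Id" using s(3) j in_U by blast
            have "(s k, i) \<in> \<kappa> - Id" using s(1)[OF k(1)] unfolding in_U .
            then have "Q f (s k) (f (s k))" "s k \<in> Field \<kappa>" using prev field by blast+
            then have "E p (f (s k))" using k(2) p unfolding Q_def by blast
            then show ?thesis using u(2) k(1) by blast
          qed
          then show ?thesis using u(1) by blast
        qed
      qed
      then obtain u where u: "\<And>x y y'. E (op x y) u \<Longrightarrow> E (op x y') u \<Longrightarrow> y = y'"
        and sub: "\<And>j p. (j, i) \<in> \<kappa> - Id \<Longrightarrow> E p (f j) \<Longrightarrow> E p u" by blast
      obtain c where c: "approximant (a0 i) (a1 i) c"
        and uc: "\<And>x y. E (op x y) u \<Longrightarrow> E x (a0 i) \<Longrightarrow> le y (a1 i) \<Longrightarrow> E (op x y) c"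
        using ex_approximant[OF om0[OF i] om1[OF i], of u] u by blast
      \<comment> \<open>Truncation loses nothing from earlier stages: both bounds increase strictly,
        so every pair in \<open>f j\<close> has its argument below \<open>a0 i\<close> and its value
        below \<open>a1 i\<close>.\<close>
      have "E p c" if j: "(j, i) \<in> \<kappa> - Id" and p: "E p (f j)" for j p
      proof -
        have "approximant (a0 j) (a1 j) (f j)" using prev[OF j] field[OF j] unfolding Q_def by blast
        then obtain x y where xy: "p = op x y" "le x (a0 j)" "le y (a1 j)"
          using p unfolding approximant_def by blast
        have "E (a0 j) (a0 i)" "E (a1 j) (a1 i)" using inc0 inc1 j by auto
        then have "E x (a0 i)" "E y (a1 i)" using xy om_trans om0[OF i] om1[OF i] by blast+
        then show ?thesis using uc sub[OF j p] xy(1) by blast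
      qed
      then show ?thesis using c unfolding Q_def by blast
    qed (simp add: Q_def)
  qed
  then obtain f where f: "\<And>i. Q f i (f i)" by blast
  \<comment> \<open>Here the path has full length, so \<open>bounded\<close> is used with
    \<open>\<kappa>\<close> itself.\<close>
  have "\<exists>u. (\<forall>x y y'. E (op x y) u \<longrightarrow> E (op x y') u \<longrightarrow> y = y') \<and> (\<forall>i\<in>Field \<kappa>. \<forall>p. E p (f i) \<longrightarrow> E p u)"
    using \<kappa> Q_seq[OF f] Q_less[OF f f]
    by (intro bounded) (auto simp: ordLeq_reflexive card_order_on_def)
  then obtain u where u: "\<forall>x y y'. E (op x y) u \<longrightarrow> E (op x y') u \<longrightarrow> y = y'"
    "\<And>i p. i \<in> Field \<kappa> \<Longrightarrow> E p (f i) \<Longrightarrow> E p u" by blast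
  have "E (op (a0 i) (a1 i)) u \<and> (\<forall>x. le x (a0 i) \<longrightarrow> (\<exists>y. le y (a1 i) \<and> E (op x y) u))"
    if i: "i \<in> Field \<kappa>" for i
  proof -
    have ap: "approximant (a0 i) (a1 i) (f i)" using f i unfolding Q_def by blast
    have "\<exists>y. le y (a1 i) \<and> E (op x y) u" if "le x (a0 i)" for x
      using approximant_total[OF ap that] u(2)[OF i] by blast
    moreover have "E (op (a0 i) (a1 i)) (f i)" using ap unfolding approximant_def by blast
    ultimately show ?thesis using u(2)[OF i] by blast
  qed
  with u(1) show ?thesis by blast
qed

section \<open>Uniqueness and existence of the coinitiality\<close>

text \<open>The interpolating \<open>u\<close> matches the lower halves of the two cuts. Overspill
  in each direction then matches the upper halves, and \<open>regular_ordIsoI\<close> compares their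
  lengths.\<close>

lemma cut_coinitiality_unique:
  fixes \<kappa> :: "'k rel"
  assumes \<kappa>: "Card_order \<kappa>" "infinite (Field \<kappa>)" and t: "below_t E \<kappa>"
    and r: "in_C E \<kappa> r" and s: "in_C E \<kappa> s"
  shows "r =o s"
proof -
  have cr: "Card_order r" "infinite (Field r)" "regularCard r" "has_cut E \<kappa> r"
    and cs: "Card_order s" "infinite (Field s)" "regularCard s" "has_cut E \<kappa> s"
    using r s unfolding in_C_def inf_regular_def by blast+
  obtain a0 b0 where a0: "\<forall>i\<in>Field \<kappa>. E (a0 i) om" and b0: "\<forall>j\<in>Field r. E (b0 j) om"
    and inc0: "\<forall>i i'. (i, i') \<in> \<kappa> \<longrightarrow> i \<noteq> i' \<longrightarrow> E (a0 i) (a0 i')"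
    and dec0: "\<forall>j j'. (j, j') \<in> r \<longrightarrow> j \<noteq> j' \<longrightarrow> E (b0 j') (b0 j)"
    and ab0: "\<forall>i\<in>Field \<kappa>. \<forall>j\<in>Field r. E (a0 i) (b0 j)"
    and gap0: "\<not> (\<exists>c. E c om \<and> (\<forall>i\<in>Field \<kappa>. E (a0 i) c) \<and> (\<forall>j\<in>Field r. E c (b0 j)))"
    using cr(4) by (rule has_cutE)
  obtain a1 b1 where a1: "\<forall>i\<in>Field \<kappa>. E (a1 i) om" and b1: "\<forall>j\<in>Field s. E (b1 j) om"
    and inc1: "\<forall>i i'. (i, i') \<in> \<kappa> \<longrightarrow> i \<noteq> i' \<longrightarrow> E (a1 i) (a1 i')"
    and dec1: "\<forall>j j'. (j, j') \<in> s \<longrightarrow> j \<noteq> j' \<longrightarrow> E (b1 j') (b1 j)"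
    and ab1: "\<forall>i\<in>Field \<kappa>. \<forall>j\<in>Field s. E (a1 i) (b1 j)"
    and gap1: "\<not> (\<exists>c. E c om \<and> (\<forall>i\<in>Field \<kappa>. E (a1 i) c) \<and> (\<forall>j\<in>Field s. E c (b1 j)))"
    using cs(4) by (rule has_cutE)
  have next_\<kappa>: "\<exists>i'\<in>Field \<kappa>. i \<noteq> i' \<and> (i, i') \<in> \<kappa>" if "i \<in> Field \<kappa>" for i
    using infinite_Card_order_limit[OF \<kappa> that] .
  have next_r: "\<exists>i'\<in>Field r. i \<noteq> i' \<and> (i, i') \<in> r" if "i \<in> Field r" for i
    using infinite_Card_order_limit[OF cr(1,2) that] .
  have next_s: "\<exists>i'\<in>Field s. i \<noteq> i' \<and> (i, i') \<in> s" if "i \<in> Field s" for i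
    using infinite_Card_order_limit[OF cs(1,2) that] .
  have tr: "E x z" if "E x y" "E y z" "E z om" for x y z using om_trans that by blast
  obtain j0 k0 where j0: "j0 \<in> Field r" and k0: "k0 \<in> Field s"
    using cr(2) cs(2) by (metis finite.emptyI ex_in_conv)
  \<comment> \<open>A single tree has to hold all approximants. Being above one upper term of each
    cut, \<open>n\<close> exceeds every \<open>S (a0 i)\<close> and every
    \<open>a1 i\<close>.\<close>
  obtain n where n: "E n om" "E (b0 j0) n" "E (b1 k0) n"
  proof -
    have "E (b0 j0) om" "E (b1 k0) om" using b0 b1 j0 k0 by auto
    then consider "E (b0 j0) (b1 k0)" | "b0 j0 = b1 k0" | "E (b1 k0) (b0 j0)" using om_linear by blast
    then show thesis
      by cases (use that[of "S (b1 k0)"] that[of "S (b0 j0)"] \<open>E (b0 j0) om\<close> \<open>E (b1 k0) om\<close> in auto)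
  qed
  have Sa0: "E (S (a0 i)) n" if "i \<in> Field \<kappa>" for i
    using S_le[of "b0 j0" "a0 i"] ab0 b0 j0 that tr n by metis
  have a1n: "E (a1 i) n" if "i \<in> Field \<kappa>" for i
    using ab1 k0 that tr n by blast
  obtain u where func: "\<forall>x y y'. E (op x y) u \<longrightarrow> E (op x y') u \<longrightarrow> y = y'"
    and u: "\<forall>i\<in>Field \<kappa>. E (op (a0 i) (a1 i)) u \<and> (\<forall>x. le x (a0 i) \<longrightarrow> (\<exists>y. le y (a1 i) \<and> E (op x y) u))"
    using ex_interpolation[OF \<kappa> t n(1), of a0 a1] Sa0 a1n inc0 inc1 by blast
  \<comment> \<open>\<open>u\<close> is defined on \<open>[0, b0 j]\<close> with values below
    \<open>b1 k\<close>. Increasing \<open>j\<close> shrinks the interval and helps; increasing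
    \<open>k\<close> lowers the bound and hurts.\<close>
  define R where "R j k \<longleftrightarrow> (\<forall>x. le x (b0 j) \<longrightarrow> (\<exists>y. E y (b1 k) \<and> E (op x y) u))" for j k
  show ?thesis
  proof (rule regular_ordIsoI[OF cr(1,3) cs(1,3), of R])
    fix j j' k assume jj': "(j, j') \<in> r" and "R j k"
    moreover have "le x (b0 j)" if "le x (b0 j')" for x
    proof (cases "j = j'")
      case False
      then have "E (b0 j') (b0 j)" "E (b0 j) om" using dec0 b0 jj' by (auto simp: Field_def)
      then show ?thesis using that tr by blast
    qed (use that in simp)
    ultimately show "R j' k" unfolding R_def by blast
  next
    fix j k k' assume kk': "(k, k') \<in> s" and "R j k'"
    moreover have "E y (b1 k)" if "E y (b1 k')" for y
    proof (cases "k = k'")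
      case False
      then have "E (b1 k') (b1 k)" "E (b1 k) om" using dec1 b1 kk' by (auto simp: Field_def)
      then show ?thesis using that tr by blast
    qed (use that in simp)
    ultimately show "R j k" unfolding R_def by blast
  next
    fix k assume k: "k \<in> Field s"
    show "\<exists>j\<in>Field r. R j k"
    proof (cases "\<forall>x. E x om \<longrightarrow> (\<exists>y. E y (b1 k) \<and> E (op x y) u)")
      case True
      have "E x om" if "le x (b0 j0)" for x using that b0 j0 om_subset by blast
      then have "R j0 k" using True unfolding R_def by blast
      then show ?thesis using j0 by blast
    next
      case False
      then obtain x1 where x1: "E x1 om" "\<not> (\<exists>y. E y (b1 k) \<and> E (op x1 y) u)" by blast
      \<comment> \<open>The least point with no value below \<open>b1 k\<close>. On
        \<open>[0, a0 i]\<close> there are values at most \<open>a1 i\<close>, so \<open>x\<close>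
        lies above every \<open>a0 i\<close>; the first gap then puts some \<open>b0 j\<close> at or
        below \<open>x\<close>, and the next term strictly below.\<close>
      obtain x where x: "E x om" "\<not> (\<exists>y. E y (b1 k) \<and> E (op x y) u)"
        "\<And>z. E z om \<Longrightarrow> \<not> (\<exists>y. E y (b1 k) \<and> E (op z y) u) \<Longrightarrow> z = x \<or> E x z"
      proof (rule om_least[where P = "\<lambda>x. \<not> (\<exists>y. E y (b1 k) \<and> E (op x y) u)", OF x1])
        show "sat E ((\<lambda>i. if i = 3 then b1 k else u)(0 := x))
          (FNeg (FEx 1 (FConj (FMem 1 3) (FEx 2 (FConj (FOpair 2 0 1) (FMem 2 4)))))) \<longleftrightarrow>
          \<not> (\<exists>y. E y (b1 k) \<and> E (op x y) u)" for x by simp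
      qed (rule that)
      have "E (a0 i) x" if i: "i \<in> Field \<kappa>" for i
      proof (rule ccontr)
        assume "\<not> E (a0 i) x"
        then have "le x (a0 i)" using om_linear a0 i x(1) by blast
        then obtain y where "le y (a1 i)" "E (op x y) u" using u i by blast
        moreover have "E (a1 i) (b1 k)" "E (b1 k) om" using ab1 b1 i k by auto
        ultimately show False using x(2) tr by blast
      qed
      then obtain j where j: "j \<in> Field r" "\<not> E x (b0 j)" using gap0 x(1) by blast
      obtain j' where j': "j' \<in> Field r" "j \<noteq> j'" "(j, j') \<in> r" using next_r j(1) by blast
      have "le (b0 j) x" using j om_linear b0 x(1) by blast
      moreover have "E (b0 j') (b0 j)" using dec0 j' by blast
      ultimately have lt: "E (b0 j') x" using tr x(1) by blast
      have "R j' k" unfolding R_def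
      proof (intro allI impI)
        fix z assume "le z (b0 j')"
        then have z: "E z x" using lt tr x(1) by blast
        then have "E z om" "\<not> (z = x \<or> E x z)" using om_subset om_asym irrefl x(1) by blast+
        then show "\<exists>y. E y (b1 k) \<and> E (op z y) u" using x(3) by blast
      qed
      then show ?thesis using j'(1) by blast
    qed
  next
    fix j assume j: "j \<in> Field r"
    show "\<exists>k\<in>Field s. \<not> R j k"
    proof (rule ccontr)
      assume "\<not> (\<exists>k\<in>Field s. \<not> R j k)"
      then have R: "R j k" if "k \<in> Field s" for k using that by blast
      \<comment> \<open>If \<open>R j k\<close> held for all \<open>k\<close>, the least bound
        \<open>w\<close> for values of \<open>u\<close> on \<open>[0, b0 j]\<close> would lie below
        every \<open>b1 k\<close>. It would also lie above every \<open>a1 i\<close>, because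
        \<open>a1 i\<close> is the only value of \<open>u\<close> at \<open>a0 i\<close>. So
        \<open>w\<close> would fill the second gap.\<close>
      let ?P = "\<lambda>w. \<forall>x. le x (b0 j) \<longrightarrow> (\<exists>y. le y w \<and> E (op x y) u)"
      have Pb: "?P (b1 k)" if "k \<in> Field s" for k using R[OF that] unfolding R_def by blast
      obtain w where w: "E w om" "?P w" "\<And>z. E z om \<Longrightarrow> ?P z \<Longrightarrow> z = w \<or> E w z"
      proof (rule om_least[where P = ?P])
        show "E (b1 k0) om" using b1 k0 by blast
        show "?P (b1 k0)" using Pb k0 by blast
        show "sat E ((\<lambda>i. if i = 3 then b0 j else u)(0 := w))
          (FAll 1 (FImp (FOr (FMem 1 3) (FEq 1 3)) (FEx 2 (FConj (FOr (FMem 2 0) (FEq 2 0))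
             (FEx 5 (FConj (FOpair 5 1 2) (FMem 5 4))))))) \<longleftrightarrow> ?P w" for w by simp
      qed (rule that)
      have "E w (b1 k)" if k: "k \<in> Field s" for k
      proof -
        obtain k' where k': "k' \<in> Field s" "k \<noteq> k'" "(k, k') \<in> s" using next_s k by blast
        have "le w (b1 k')" using w(3) Pb b1 k'(1) by blast
        moreover have "E (b1 k') (b1 k)" "E (b1 k) om" using dec1 b1 k k' by auto
        ultimately show ?thesis using tr by blast
      qed
      moreover have "E (a1 i) w" if i: "i \<in> Field \<kappa>" for i
      proof -
        obtain i' where i': "i' \<in> Field \<kappa>" "i \<noteq> i'" "(i, i') \<in> \<kappa>" using next_\<kappa> i by blast
        have "E (a0 i') (b0 j)" using ab0 i'(1) j by blast
        then obtain y where y: "le y w" "E (op (a0 i') y) u" using w(2) by blast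
        moreover have "E (op (a0 i') (a1 i')) u" using u i'(1) by blast
        ultimately have "y = a1 i'" using func by blast
        moreover have "E (a1 i) (a1 i')" using inc1 i' by blast
        ultimately show ?thesis using y(1) tr w(1) by blast
      qed
      ultimately show False using gap1 w(1) by blast
    qed
  qed
qed

section \<open>The standard cut and the existence of a coinitiality\<close>

definition standard :: "nat \<Rightarrow> 'm" where "standard k = (S ^^ k) zero"

lemma standard_om: "E (standard k) om"
  by (induction k) (simp_all add: standard_def)

lemma standard_Suc: "standard (Suc k) = S (standard k)"
  by (simp add: standard_def)

lemma mem_standard: "E x (standard k) \<longleftrightarrow> (\<exists>l<k. x = standard l)"
  by (induction k) (auto simp: standard_Suc less_Suc_eq, simp add: standard_def)

lemma standard_less_iff: "E (standard k) (standard l) \<longleftrightarrow> k < l"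
proof -
  have less: "E (standard k) (standard l)" if "k < l" for k l using that mem_standard by blast
  show ?thesis
  proof
    assume E: "E (standard k) (standard l)"
    then show "k < l" using less[of l k] om_asym[OF standard_om E] irrefl
      by (metis linorder_neqE_nat)
  qed (rule less)
qed

text \<open>Otherwise \<open>standard\<close> would be an isomorphism between the natural numbers
  and \<open>omega_hat E\<close>.\<close>

lemma ex_nonstandard:
  assumes "omega_nonstandard E" shows "\<exists>N. E N om \<and> N \<notin> range standard"
proof (rule ccontr)
  assume "\<not> ?thesis"
  then have "range standard = omega_hat E" using standard_om unfolding omega_hat_eq by auto
  moreover have "inj standard"
    using standard_less_iff irrefl by (metis injI linorder_neqE_nat)
  ultimately have "bij_betw standard UNIV (omega_hat E)" by (simp add: bij_betw_def)
  then show False using assms standard_less_iff unfolding omega_nonstandard_def by blast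
qed

lemma standard_less_nonstandard:
  assumes "E x om" "x \<notin> range standard" shows "E (standard k) x"
proof -
  have "\<not> E x (standard k)" "x \<noteq> standard k" using assms mem_standard by auto
  then show ?thesis using om_linear[OF assms(1) standard_om] by blast
qed

lemma ex_coinitial:
  assumes "U \<subseteq> {x. E x om}" "U \<noteq> {}" "\<And>x. x \<in> U \<Longrightarrow> \<exists>y\<in>U. E y x"
  obtains r :: "'m rel" and b where "inf_regular r" "\<And>j. j \<in> Field r \<Longrightarrow> b j \<in> U"
    "\<And>i j. (i, j) \<in> r \<Longrightarrow> i \<noteq> j \<Longrightarrow> E (b j) (b i)" "\<And>x. x \<in> U \<Longrightarrow> \<exists>j\<in>Field r. E (b j) x"
proof (rule coinitial_sequence[of U E])
  show "E x z" if "x \<in> U" "y \<in> U" "z \<in> U" "E x y" "E y z" for x y z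
    using that assms(1) om_trans by blast
  show "E x y \<or> x = y \<or> E y x" if "x \<in> U" "y \<in> U" for x y
    using that assms(1) om_linear by blast
  show "\<not> E x x" for x by (rule irrefl)
  show "\<exists>y\<in>U. E y x" if "x \<in> U" for x using assms(3) that .
  fix r :: "'m rel" and b :: "'m \<Rightarrow> 'm"
  assume "Card_order r" "infinite (Field r)" "regularCard r" "\<And>i. i \<in> Field r \<Longrightarrow> b i \<in> U"
    "\<And>i j. (i, j) \<in> r \<Longrightarrow> i \<noteq> j \<Longrightarrow> E (b j) (b i)" "\<And>x. x \<in> U \<Longrightarrow> \<exists>i\<in>Field r. E (b i) x"
  then show thesis by (intro that[of r b]) (simp_all add: inf_regular_def)
qed (rule assms(2))

text \<open>The cut between the standard and the nonstandard numbers has a countable lower side, so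
  \<open>\<kappa> \<le> p\<close> bounds \<open>\<kappa>\<close> by its coinitiality.\<close>

lemma ex_decreasing:
  fixes \<kappa> :: "'k rel"
  assumes nonst: "omega_nonstandard E" and \<kappa>: "inf_regular \<kappa>" and p: "below_p_plus E \<kappa>"
  obtains N d where "E N om" "\<And>i. i \<in> Field \<kappa> \<Longrightarrow> E (d i) N" "\<And>i. i \<in> Field \<kappa> \<Longrightarrow> E zero (d i)"
    "\<And>i j. (i, j) \<in> \<kappa> \<Longrightarrow> i \<noteq> j \<Longrightarrow> E (d j) (d i)"
proof -
  obtain N where N: "E N om" "N \<notin> range standard" using ex_nonstandard[OF nonst] by blast
  \<comment> \<open>The nonstandard numbers, capped at \<open>N\<close> so that the decreasing
    sequence drawn from them is bounded.\<close>
  define U where "U = {x. E x om \<and> x \<notin> range standard \<and> le x N}"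
  have Uom: "U \<subseteq> {x. E x om}" unfolding U_def by blast
  have "N \<in> U" using N unfolding U_def by blast
  have pred: "\<exists>y\<in>U. E y x" if x: "x \<in> U" for x
  proof -
    have "zero = standard 0" by (simp add: standard_def)
    then have "E x om" "x \<noteq> zero" using x unfolding U_def by blast+
    then obtain y where y: "E y om" "x = S y" by (rule ex_pred)
    have "y \<notin> range standard" using x y(2) unfolding U_def by (metis (mono_tags, lifting) standard_Suc imageE mem_Collect_eq rangeI)
    moreover have "E y x" using y(2) by simp
    moreover from this have "E y N" using x om_trans[OF N(1)] unfolding U_def by blast
    ultimately show ?thesis using y(1) unfolding U_def by blast
  qed
  obtain r :: "'m rel" and b where r: "inf_regular r" and b: "\<And>j. j \<in> Field r \<Longrightarrow> b j \<in> U"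
    and dec: "\<And>i j. (i, j) \<in> r \<Longrightarrow> i \<noteq> j \<Longrightarrow> E (b j) (b i)"
    and coin: "\<And>x. x \<in> U \<Longrightarrow> \<exists>j\<in>Field r. E (b j) x"
    by (rule ex_coinitial[OF Uom _ pred]) (use \<open>N \<in> U\<close> in blast, blast, rule that)
  \<comment> \<open>The standard numbers are indexed by a relation on \<open>'m\<close>, because
    that is the type over which \<open>below_p_plus\<close> ranges.\<close>
  obtain m a where m: "Card_order m" "infinite (Field m)" "regularCard m" "Field m \<subseteq> range standard"
    and a: "\<And>i. i \<in> Field m \<Longrightarrow> a i \<in> range standard"
    and inc: "\<And>i j. (i, j) \<in> m \<Longrightarrow> i \<noteq> j \<Longrightarrow> E (a i) (a j)"
    and cof: "\<And>x. x \<in> range standard \<Longrightarrow> \<exists>i\<in>Field m. E x (a i)"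
  proof (rule coinitial_sequence[of "range standard" "\<lambda>x y. E y x"])
    show "E z x" if "x \<in> range standard" "E y x" "E z y" for x y z
      using that om_trans standard_om by blast
    show "E y x \<or> x = y \<or> E x y" if "x \<in> range standard" "y \<in> range standard" for x y
      using that om_linear standard_om by blast
    show "\<exists>y\<in>range standard. E x y" if "x \<in> range standard" for x
      using that standard_less_iff by blast
    show "\<not> E x x" for x by (rule irrefl)
  qed (simp, rule that)
  have "has_cut E m r"
  proof (rule has_cutI)
    show "E (a i) om" if "i \<in> Field m" for i using a[OF that] standard_om by auto
    show "E (b j) om" if "j \<in> Field r" for j using b[OF that] Uom by blast
    show "E (a i) (b j)" if "i \<in> Field m" "j \<in> Field r" for i j
      using a[OF that(1)] b[OF that(2)] standard_less_nonstandard[of "b j"] unfolding U_def by auto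
    fix c assume c: "E c om" "\<forall>i\<in>Field m. E (a i) c" "\<forall>j\<in>Field r. E c (b j)"
    have "c \<notin> range standard" using cof c(1,2) om_asym by blast
    moreover have "E c N"
    proof -
      obtain j where "j \<in> Field r" "E (b j) N" using coin \<open>N \<in> U\<close> by blast
      then show ?thesis using c(3) om_trans N(1) by blast
    qed
    ultimately have "c \<in> U" using c(1) unfolding U_def by blast
    then show False using coin c(1,3) om_asym by blast
  qed (use inc dec in blast)+
  then have "\<kappa> \<le>o m \<or> \<kappa> \<le>o r"
    using p r m unfolding below_p_plus_def in_C_def inf_regular_def by blast
  \<comment> \<open>\<open>m\<close> lives on the countable set of standard numbers and
    \<open>r\<close> is infinite, so \<open>\<kappa>\<close> is at most \<open>r\<close> in either
    case.\<close>
  moreover have "m \<le>o r"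
  proof -
    have cr: "Card_order r" "infinite (Field r)" using r unfolding inf_regular_def by blast+
    have "|Field m| \<le>o |range standard|" using m(4) by (rule card_of_mono1)
    also have "|range standard| \<le>o |UNIV :: nat set|" by (rule card_of_image)
    also have "|UNIV :: nat set| \<le>o |Field r|" using cr(2) infinite_iff_card_of_nat by blast
    finally have "|Field m| \<le>o |Field r|" .
    then show ?thesis using card_of_Field_ordIso[OF m(1)] card_of_Field_ordIso[OF cr(1)]
      by (meson ordIso_ordLeq_trans ordIso_symmetric ordLeq_ordIso_trans)
  qed
  ultimately have "\<kappa> \<le>o r" using ordLeq_transitive by blast
  \<comment> \<open>An embedding of \<open>\<kappa>\<close> into \<open>r\<close> selects a
    decreasing subsequence of length \<open>\<kappa>\<close>; coinitiality may be lost.\<close>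
  then obtain f where f: "embed \<kappa> r f" and wo: "Well_order \<kappa>" "Well_order r"
    unfolding ordLeq_def by blast
  have f_in: "f i \<in> Field r" if "i \<in> Field \<kappa>" for i
    using embed_Field[OF f] that by blast
  have "E (b (f j)) (b (f i))" if "(i, j) \<in> \<kappa>" "i \<noteq> j" for i j
  proof (rule dec)
    show "(f i, f j) \<in> r" using embed_compat[OF f] that(1) unfolding compat_def by blast
    show "f i \<noteq> f j" using embed_inj_on[OF wo(1) f] that unfolding inj_on_def Field_def by blast
  qed
  moreover have "E (b (f i)) (S N)" "E zero (b (f i))" if "i \<in> Field \<kappa>" for i
    using b[OF f_in[OF that]] standard_less_nonstandard[of _ 0] unfolding U_def by (auto simp: standard_def)
  ultimately show thesis using N(1) by (intro that[of "S N" "\<lambda>i. b (f i)"]) auto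
qed

text \<open>Reflecting the decreasing sequence gives a bounded increasing one. Its set
  \<open>U\<close> of upper bounds has no least element, since the predecessor of a bound is still
  above every term of a sequence without a last term. A coinitial sequence in \<open>U\<close>
  therefore completes the cut.\<close>

lemma ex_cut:
  fixes \<kappa> :: "'k rel"
  assumes "omega_nonstandard E" "inf_regular \<kappa>" "below_p_plus E \<kappa>"
  shows "\<exists>\<theta> :: 'm rel. in_C E \<kappa> \<theta>"
proof -
  obtain N d where N: "E N om" and dN: "\<And>i. i \<in> Field \<kappa> \<Longrightarrow> E (d i) N"
    and d0: "\<And>i. i \<in> Field \<kappa> \<Longrightarrow> E zero (d i)"
    and dec: "\<And>i j. (i, j) \<in> \<kappa> \<Longrightarrow> i \<noteq> j \<Longrightarrow> E (d j) (d i)"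
    by (rule ex_decreasing[OF assms]) (rule that)
  obtain g h where h: "\<And>x. E x N \<Longrightarrow> E (h x) om"
    and anti: "\<And>x x'. E x' N \<Longrightarrow> E x x' \<Longrightarrow> E (h x') (h x)"
    by (rule ex_antitone[OF N]) (rule that)
  have \<kappa>: "Card_order \<kappa>" "infinite (Field \<kappa>)" using assms(2) unfolding inf_regular_def by blast+
  define a where "a i = h (d i)" for i
  have a: "E (a i) om" if "i \<in> Field \<kappa>" for i using h dN that unfolding a_def by blast
  have inc: "E (a i) (a j)" if "(i, j) \<in> \<kappa>" "i \<noteq> j" for i j
    unfolding a_def using anti dN dec that by (metis FieldI1)
  define U where "U = {x. E x om \<and> (\<forall>i\<in>Field \<kappa>. E (a i) x)}"
  obtain i0 where i0: "i0 \<in> Field \<kappa>" using \<kappa>(2) by (metis finite.emptyI ex_in_conv)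
  have "E zero N" using om_trans[OF N dN[OF i0] d0[OF i0]] .
  \<comment> \<open>Every \<open>d i\<close> is above \<open>zero\<close>, so the reflection of
    \<open>zero\<close> is above every \<open>a i\<close>.\<close>
  then have "h zero \<in> U" using h anti dN d0 unfolding U_def a_def by blast
  have pred: "\<exists>y\<in>U. E y x" if x: "x \<in> U" for x
  proof -
    have "E (a i0) x" using x i0 unfolding U_def by blast
    then have "E x om" "x \<noteq> zero" using x unfolding U_def by auto
    then obtain y where y: "E y om" "x = S y" by (rule ex_pred)
    have "E (a i) y" if i: "i \<in> Field \<kappa>" for i
    proof -
      obtain i' where i': "i' \<in> Field \<kappa>" "i \<noteq> i'" "(i, i') \<in> \<kappa>"
        using infinite_Card_order_limit[OF \<kappa> i] by blast
      have "E (a i') x" using x i'(1) unfolding U_def by blast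
      then have "le (a i') y" using y(2) by simp
      moreover have "E (a i) (a i')" using inc i' by blast
      ultimately show ?thesis using om_trans[OF y(1)] by blast
    qed
    then show ?thesis using y unfolding U_def by auto
  qed
  have Uom: "U \<subseteq> {x. E x om}" unfolding U_def by blast
  obtain \<theta> :: "'m rel" and b where \<theta>: "inf_regular \<theta>" and b: "\<And>j. j \<in> Field \<theta> \<Longrightarrow> b j \<in> U"
    and decb: "\<And>i j. (i, j) \<in> \<theta> \<Longrightarrow> i \<noteq> j \<Longrightarrow> E (b j) (b i)"
    and coin: "\<And>x. x \<in> U \<Longrightarrow> \<exists>j\<in>Field \<theta>. E (b j) x"
    by (rule ex_coinitial[OF Uom _ pred]) (use \<open>h zero \<in> U\<close> in blast, blast, rule that)
  have "has_cut E \<kappa> \<theta>"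
  proof (rule has_cutI)
    fix c assume c: "E c om" "\<forall>i\<in>Field \<kappa>. E (a i) c" "\<forall>j\<in>Field \<theta>. E c (b j)"
    then have "c \<in> U" unfolding U_def by blast
    then show False using coin c(1,3) om_asym by blast
  qed (use a b inc decb in \<open>auto simp: U_def\<close>)
  then show ?thesis using \<theta> assms(2) unfolding in_C_def by blast
qed

lemma in_C_swap: "in_C E r s \<Longrightarrow> in_C E s r"
  unfolding in_C_def inf_regular_def using has_cut_swap by blast

end

theorem mainTheorem5:
  fixes E :: "'m \<Rightarrow> 'm \<Rightarrow> bool" and \<kappa> :: "'k rel"
  assumes "zfc_minus E"
    and "omega_nonstandard E"
    and "inf_regular \<kappa>"
    and "below_p_plus E \<kappa>"
    and "below_t E \<kappa>"
  shows "\<exists>\<theta> :: 'm rel.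
           in_C E \<kappa> \<theta> \<and> (\<forall>\<mu> :: 'l rel. in_C E \<kappa> \<mu> \<longrightarrow> (\<mu>, \<theta>) \<in> ordIso) \<and>
           in_C E \<theta> \<kappa> \<and> (\<forall>\<mu> :: 'l rel. in_C E \<mu> \<kappa> \<longrightarrow> (\<mu>, \<theta>) \<in> ordIso)"
proof -
  interpret zfc_minus_model E using assms(1) by unfold_locales
  obtain \<theta> :: "'m rel" where \<theta>: "in_C E \<kappa> \<theta>" using ex_cut[OF assms(2-4)] by blast
  \<comment> \<open>The competing cardinal \<open>\<mu>\<close> and the witness
    \<open>\<theta>\<close> live on different types, which the uniqueness lemma allows. Cuts with
    \<open>\<kappa>\<close> above reduce to this case by reflection.\<close>
  have "\<mu> =o \<theta>" if "in_C E \<kappa> \<mu>" for \<mu> :: "'l rel"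
    using cut_coinitiality_unique[OF _ _ assms(5) that \<theta>] assms(3) unfolding inf_regular_def by blast
  moreover from this have "\<mu> =o \<theta>" if "in_C E \<mu> \<kappa>" for \<mu> :: "'l rel"
    using in_C_swap[OF that] by blast
  ultimately show ?thesis using \<theta> in_C_swap[OF \<theta>] by blast
qed

end
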